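(* For $a,r\in(0,1)$ let $$f_6(r)=\mathscr{K}_a(\sqrt r)-\frac{\mathscr{E}_a(\sqrt r)-(1-r)\mathscr{K}_a(\sqrt r)}{a\,\alpha\,r\,F(a,3/2-a;5/2;r)}\,F\left(a,\tfrac32-a;\tfrac32;r\right),$$ $$h_{13}(r)=\frac{\mathscr{E}(\sqrt r)-(1-r)\mathscr{K}(\sqrt r)}{1-(1-r)(\operatorname{artanh}\sqrt r)/\sqrt r},\qquad f_7(r)=\mathscr{K}(\sqrt r)-h_{13}(r)\frac{\operatorname{artanh}\sqrt r}{\sqrt r}.$$ Then for each $a\in(0,1)$, $f_6$ and $f_7$ are both absolutely monotone on $(0,1)$, with ranges $(\pi\eta/2,\pi\beta/2)$ and $(\pi/8,\log2)$, respectively. In particular, for all $r\in(0,1)$, $$\frac\pi8+\frac{3\pi}{8}\left[1-\frac{3}{40}r^2-\frac{267}{11200}r^4-\frac{32279}{2688000}r^6-\left(\frac{2390041}{2688000}-\frac{8}{3\pi}\right)r^8\right]\frac{\operatorname{artanh}r}{r}$$ $$<\frac\pi8+h_{13}(r^2)\frac{\operatorname{artanh}r}{r}<\mathscr{K}(r)<\frac\pi8+h_{13}(r^2)\frac{\operatorname{artanh}r}{r}+\left(\log2-\frac\pi8\right)r^2$$ $$<\frac\pi8+\left(\log2-\frac\pi8\right)r^2+\frac{3\pi}{8}\left(1-\frac{3}{40}r^2-\frac{267}{11200}r^4-\frac{32279}{2688000}r^6-\frac{40472969}{5519360000}r^8\right)\frac{\operatorname{artanh}r}{r},$$ in which all the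 constants are best possible (no single one of them can be replaced, the others being kept fixed, by a constant that makes the bound in which it occurs sharper, so that the chain still holds for all $r\in(0,1)$).
   Context: $(a)_0=1$, $(a)_n=a(a+1)\cdots(a+n-1)$. For $|x|<1$, $F(a,b;c;x)=\sum_{n=0}^\infty\frac{(a)_n(b)_n}{(c)_n\,n!}x^n$. For $a,r\in(0,1)$: $\mathscr{K}_a(r)=\frac\pi2F(a,1-a;1;r^2)$, $\mathscr{E}_a(r)=\frac\pi2F(a-1,1-a;1;r^2)$; $\mathscr{K}=\mathscr{K}_{1/2}$, $\mathscr{E}=\mathscr{E}_{1/2}$. For $a\in(0,1)$: $\alpha=\frac{3-2a}{3(1-a)}$, $\eta=\frac{a}{3-2a}$, $\beta=\frac{\psi(3/2-a)-\psi(1-a)}{B(a,1-a)}$, with $\psi=\Gamma'/\Gamma$ and $B(x,y)=\Gamma(x)\Gamma(y)/\Gamma(x+y)$. A function is absolutely monotone on an interval if it and all its derivatives are nonnegative there. *)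

theory Defs
  imports "HOL-Analysis.Analysis"
begin

definition hyp2F1 :: "real \<Rightarrow> real \<Rightarrow> real \<Rightarrow> real \<Rightarrow> real" where
  "hyp2F1 a b c x = (\<Sum>n. pochhammer a n * pochhammer b n / (pochhammer c n * fact n) * x ^ n)"

definition gen_ellipticK :: "real \<Rightarrow> real \<Rightarrow> real" where
  "gen_ellipticK a r = pi / 2 * hyp2F1 a (1 - a) 1 (r\<^sup>2)"

definition gen_ellipticE :: "real \<Rightarrow> real \<Rightarrow> real" where
  "gen_ellipticE a r = pi / 2 * hyp2F1 (a - 1) (1 - a) 1 (r\<^sup>2)"

abbreviation ellipticK :: "real \<Rightarrow> real" where
  "ellipticK \<equiv> gen_ellipticK (1 / 2)"

abbreviation ellipticE :: "real \<Rightarrow> real" where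
  "ellipticE \<equiv> gen_ellipticE (1 / 2)"

definition alpha_const :: "real \<Rightarrow> real" where
  "alpha_const a = (3 - 2 * a) / (3 * (1 - a))"

definition eta_const :: "real \<Rightarrow> real" where
  "eta_const a = a / (3 - 2 * a)"

definition beta_const :: "real \<Rightarrow> real" where
  "beta_const a = (Digamma (3 / 2 - a) - Digamma (1 - a)) / Beta a (1 - a)"

text \<open>
  Intended for open sets only: \<^const>\<open>deriv\<close> is the two-sided derivative.
  Differentiability is demanded explicitly because \<^const>\<open>deriv\<close> is a total function.
\<close>
definition absolutely_monotone_on :: "(real \<Rightarrow> real) \<Rightarrow> real set \<Rightarrow> bool" where
  "absolutely_monotone_on f S \<longleftrightarrow>
     (\<forall>n. \<forall>x\<in>S. (deriv ^^ n) f field_differentiable at x \<and> 0 \<le> (deriv ^^ n) f x)"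

definition f6 :: "real \<Rightarrow> real \<Rightarrow> real" where
  "f6 a r = gen_ellipticK a (sqrt r)
     - (gen_ellipticE a (sqrt r) - (1 - r) * gen_ellipticK a (sqrt r))
         / (a * alpha_const a * r * hyp2F1 a (3 / 2 - a) (5 / 2) r)
       * hyp2F1 a (3 / 2 - a) (3 / 2) r"

definition h13 :: "real \<Rightarrow> real" where
  "h13 r = (ellipticE (sqrt r) - (1 - r) * ellipticK (sqrt r))
             / (1 - (1 - r) * (artanh (sqrt r) / sqrt r))"

definition f7 :: "real \<Rightarrow> real" where
  "f7 r = ellipticK (sqrt r) - h13 r * (artanh (sqrt r) / sqrt r)"

text \<open>
  The four bounds of the chain as functions of the list of constants occurring in them, in
  order of appearance.  A compound coefficient such as \<open>log 2 - \<pi>/8\<close> counts as one constant,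
  and each bound has its own copy of a value such as \<open>\<pi>/8\<close> that occurs in several bounds.
\<close>
definition lower_outer :: "real list \<Rightarrow> real \<Rightarrow> real" where
  "lower_outer p r =
     p!0 + p!1 * (p!2 - p!3 * r^2 - p!4 * r^4 - p!5 * r^6 - p!6 * r^8) * (artanh r / r)"

definition lower_inner :: "real list \<Rightarrow> real \<Rightarrow> real" where
  "lower_inner p r = p!0 + h13 (r\<^sup>2) * (artanh r / r)"

definition upper_inner :: "real list \<Rightarrow> real \<Rightarrow> real" where
  "upper_inner p r = p!0 + h13 (r\<^sup>2) * (artanh r / r) + p!1 * r^2"

definition upper_outer :: "real list \<Rightarrow> real \<Rightarrow> real" where
  "upper_outer p r = p!0 + p!1 * r^2
     + p!2 * (p!3 - p!4 * r^2 - p!5 * r^4 - p!6 * r^6 - p!7 * r^8) * (artanh r / r)"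

definition K_chain ::
    "(real \<Rightarrow> real) \<Rightarrow> (real \<Rightarrow> real) \<Rightarrow> (real \<Rightarrow> real) \<Rightarrow> (real \<Rightarrow> real) \<Rightarrow> bool" where
  "K_chain l1 l2 u1 u2 \<longleftrightarrow>
     (\<forall>r\<in>{0<..<1}. l1 r < l2 r \<and> l2 r < ellipticK r \<and> ellipticK r < u1 r \<and> u1 r < u2 r)"

definition sharper_lower :: "(real \<Rightarrow> real) \<Rightarrow> (real \<Rightarrow> real) \<Rightarrow> bool" where
  "sharper_lower g f \<longleftrightarrow> (\<forall>r\<in>{0<..<1}. f r \<le> g r) \<and> (\<exists>r\<in>{0<..<1}. f r < g r)"

definition sharper_upper :: "(real \<Rightarrow> real) \<Rightarrow> (real \<Rightarrow> real) \<Rightarrow> bool" where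
  "sharper_upper g f \<longleftrightarrow> (\<forall>r\<in>{0<..<1}. g r \<le> f r) \<and> (\<exists>r\<in>{0<..<1}. g r < f r)"

end

theory Submission
  imports Defs "HOL-Real_Asymp.Real_Asymp"
begin

text \<open>
  Put \<open>U = F(a, 1-a; 1; x)\<close>, \<open>P = F(a, 3/2-a; 3/2; x)\<close>, \<open>G = F(a, 1-a; 2; x)\<close> and
  \<open>Q = F(a, 3/2-a; 5/2; x)\<close>. Then \<open>f6 = (\<pi>/2) (U - h P)\<close> with \<open>h = G / (\<alpha> Q) = U' / P'\<close>, so that
  \<open>f6' = -(\<pi>/2) h' P\<close>. Since the coefficients of \<open>Q\<close> are log-convex and the ratios of the
  coefficients of \<open>G\<close> and \<open>Q\<close> decrease, a Kaluza-type argument shows that all coefficients of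
  \<open>G / Q\<close> except the constant one are negative; hence \<open>f6\<close> has positive coefficients.

  With \<open>\<lambda> = h(1)\<close> write \<open>U - h P = (U - \<lambda> P) - (h - \<lambda>) P\<close>. At \<open>x = 1\<close> the second term vanishes, because
  \<open>h - \<lambda> = O(sqrt (1 - x))\<close> while \<open>P\<close> grows logarithmically, and the first one converges to
  \<open>\<Sum>n. (a)\<^sub>n / n! (B(a, 1-a+n) - B(a, 3/2-a+n)) / B(a, 1-a)\<close>, a telescoping sum equal to \<open>\<beta>\<close>.

  For \<open>a = 1/2\<close> one has \<open>P = artanh (sqrt x) / sqrt x\<close>, \<open>h13 = (\<pi>/2) h\<close> and \<open>f7 = f6\<close>. The two outer
  bounds come from replacing the tail of the series of \<open>h13\<close> beyond \<open>x\<^sup>3\<close> by its extreme values at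
  \<open>1\<close> and at \<open>0\<close>. Each constant is optimal since the gap it controls is of smaller order at \<open>0\<close> or at
  \<open>1\<close> than the effect of changing it.
\<close>

section \<open>Power series and their quotients\<close>

lemma summable_powser_bounded:
  fixes c :: "nat \<Rightarrow> real"
  assumes "\<And>n. \<bar>c n\<bar> \<le> C" "\<bar>x\<bar> < 1"
  shows "summable (\<lambda>n. norm (c n * x ^ n))"
proof (rule summable_comparison_test')
  show "summable (\<lambda>n. C * \<bar>x\<bar> ^ n)"
    using assms(2) by (intro summable_mult summable_geometric) auto
  show "norm (norm (c n * x ^ n)) \<le> C * \<bar>x\<bar> ^ n" if "n \<ge> 0" for n
    using assms(1)[of n] by (simp add: abs_mult power_abs mult_right_mono)
qed

lemma powser_mult:
  fixes b c :: "nat \<Rightarrow> real"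
  assumes "summable (\<lambda>n. norm (b n * x ^ n))" "summable (\<lambda>n. norm (c n * x ^ n))"
  shows "(\<lambda>n. (\<Sum>i\<le>n. b i * c (n - i)) * x ^ n) sums
    ((\<Sum>n. b n * x ^ n) * (\<Sum>n. c n * x ^ n))"
proof -
  have "(\<Sum>i\<le>n. b i * x ^ i * (c (n - i) * x ^ (n - i))) = (\<Sum>i\<le>n. b i * c (n - i)) * x ^ n" for n
    unfolding sum_distrib_right
  proof (rule sum.cong)
    fix i assume "i \<in> {..n}"
    then have "x ^ n = x ^ i * x ^ (n - i)"
      by (simp flip: power_add)
    then show "b i * x ^ i * (c (n - i) * x ^ (n - i)) = b i * c (n - i) * x ^ n"
      by simp
  qed simp
  with Cauchy_product_sums[OF assms] show ?thesis
    by simp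
qed

text \<open>Termwise differentiation keeps the coefficients nonnegative, so every iterated
  derivative inherits the whole situation; its coefficient sequence is carried existentially through
  the induction.\<close>

lemma absolutely_monotone_on_powser:
  fixes f :: "real \<Rightarrow> real"
  assumes c: "\<And>n. 0 \<le> c n"
    and sums: "\<And>x. \<bar>x\<bar> < 1 \<Longrightarrow> summable (\<lambda>n. c n * x ^ n)"
    and f: "\<And>x. x \<in> {0<..<1} \<Longrightarrow> f x = (\<Sum>n. c n * x ^ n)"
  shows "absolutely_monotone_on f {0<..<1}"
proof -
  \<comment> \<open>Summability is carried on the full disc, as termwise differentiation needs it on
    both sides of \<open>0\<close>. The identity with the derivative lives on the open interval,
    which is enough for \<open>deriv\<close>.\<close>
  have *: "\<exists>c. (\<forall>n. 0 \<le> c n) \<and> (\<forall>x. \<bar>x\<bar> < 1 \<longrightarrow> summable (\<lambda>n. c n * x ^ n)) \<and>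
      (\<forall>x\<in>{0<..<1}. (deriv ^^ k) f x = (\<Sum>n. c n * x ^ n))" for k
  proof (induction k)
    case 0
    show ?case
      using assms by (intro exI[of _ c]) auto
  next
    case (Suc k)
    then obtain c where c: "\<And>n. 0 \<le> c n" "\<And>x. \<bar>x\<bar> < 1 \<Longrightarrow> summable (\<lambda>n. c n * x ^ n)"
      and eq: "\<And>x. x \<in> {0<..<1} \<Longrightarrow> (deriv ^^ k) f x = (\<Sum>n. c n * x ^ n)"
      by blast
    have "deriv ((deriv ^^ k) f) x = (\<Sum>n. diffs c n * x ^ n)" if x: "x \<in> {0<..<1}" for x
    proof (rule DERIV_imp_deriv)
      have "((\<lambda>x. \<Sum>n. c n * x ^ n) has_field_derivative (\<Sum>n. diffs c n * x ^ n)) (at x)"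
        by (rule termdiffs_strong'[where K = 1]) (use x c in auto)
      then show "((deriv ^^ k) f has_field_derivative (\<Sum>n. diffs c n * x ^ n)) (at x)"
        by (rule has_field_derivative_transform_within_open[where S = "{0<..<1}"])
          (use x eq in auto)
    qed
    moreover have "summable (\<lambda>n. diffs c n * x ^ n)" if "\<bar>x\<bar> < 1" for x
      by (rule termdiff_converges[where K = 1]) (use that c in auto)
    moreover have "0 \<le> diffs c n" for n
      using c by (simp add: diffs_def)
    ultimately show ?case
      by (intro exI[of _ "diffs c"]) simp
  qed
  show ?thesis
    unfolding absolutely_monotone_on_def
  proof (intro allI ballI conjI)
    fix k and x :: real
    assume x: "x \<in> {0<..<1}"
    from *[of k] obtain c where c: "\<And>n. 0 \<le> c n" "\<And>x. \<bar>x\<bar> < 1 \<Longrightarrow> summable (\<lambda>n. c n * x ^ n)"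
      and eq: "\<And>x. x \<in> {0<..<1} \<Longrightarrow> (deriv ^^ k) f x = (\<Sum>n. c n * x ^ n)"
      by blast
    have "((\<lambda>x. \<Sum>n. c n * x ^ n) has_field_derivative (\<Sum>n. diffs c n * x ^ n)) (at x)"
      by (rule termdiffs_strong'[where K = 1]) (use x c in auto)
    then have "((deriv ^^ k) f has_field_derivative (\<Sum>n. diffs c n * x ^ n)) (at x)"
      by (rule has_field_derivative_transform_within_open[where S = "{0<..<1}"])
        (use x eq in auto)
    then show "(deriv ^^ k) f field_differentiable at x"
      unfolding field_differentiable_def by blast
    show "0 \<le> (deriv ^^ k) f x"
      unfolding eq[OF x] using x c by (intro suminf_nonneg) auto
  qed
qed

text \<open>
  With \<open>g = d q\<close>, subtracting \<open>q (n + 1) / q n\<close> times the \<open>n\<close>-th convolution identity from the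
  next one eliminates \<open>h 0\<close> and leaves only terms of known sign.
\<close>
lemma quotient_coeffs_neg:
  fixes g h q :: "nat \<Rightarrow> real"
  assumes q0: "q 0 = 1" and q: "\<And>n. 0 < q n"
    and convex: "\<And>m n. m \<le> n \<Longrightarrow> q (Suc m) * q n \<le> q m * q (Suc n)"
    and decr: "\<And>n. g (Suc n) * q n < g n * q (Suc n)"
    and conv: "\<And>n. g n = (\<Sum>k\<le>n. h k * q (n - k))"
  shows "h (Suc n) < 0"
proof (induction n rule: less_induct)
  case (less n)
  have split: "{..n} = insert 0 {1..n}"
    by auto
  have "g (Suc n) = h (Suc n) + (\<Sum>k\<le>n. h k * q (Suc n - k))"
    using conv[of "Suc n"] q0 by simp
  then have "h (Suc n) * q n = g (Suc n) * q n - (\<Sum>k\<le>n. h k * q (Suc n - k)) * q n"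
    by (simp add: algebra_simps)
  also have "\<dots> < g n * q (Suc n) - (\<Sum>k\<le>n. h k * q (Suc n - k)) * q n"
    using decr[of n] by simp
  also have "\<dots> = (\<Sum>k\<le>n. h k * (q (n - k) * q (Suc n) - q (Suc n - k) * q n))"
    by (subst conv[of n]) (simp add: sum_distrib_left sum_distrib_right sum_subtractf algebra_simps)
  also have "\<dots> = (\<Sum>k=1..n. h k * (q (n - k) * q (Suc n) - q (Suc n - k) * q n))"
    unfolding split by simp
  also have "\<dots> \<le> 0"
  proof (rule sum_nonpos)
    fix k assume k: "k \<in> {1..n}"
    then have "h k < 0"
      using less.IH[of "k - 1"] by (cases k) auto
    moreover have "q (Suc n - k) * q n \<le> q (n - k) * q (Suc n)"
      using convex[of "n - k" n] k by (simp add: Suc_diff_le)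
    ultimately show "h k * (q (n - k) * q (Suc n) - q (Suc n - k) * q n) \<le> 0"
      by (simp add: mult_nonpos_nonneg)
  qed
  finally show ?case
    using q[of n] by (simp add: mult_less_0_iff)
qed

text \<open>In the convolution the terms with \<open>1 \<le> k \<le> m\<close> are nonpositive and
  \<open>g n\<close> is nonnegative, so \<open>- h n\<close> cannot exceed the term
  \<open>k = 0\<close>, which is \<open>g 0 * q n\<close>. This passes the decay of the denominator
  on to the quotient.\<close>

lemma quotient_coeffs_bound:
  fixes g h q :: "nat \<Rightarrow> real"
  assumes q0: "q 0 = 1" and q: "\<And>n. 0 < q n"
    and g: "\<And>n. 0 \<le> g n"
    and conv: "\<And>n. g n = (\<Sum>k\<le>n. h k * q (n - k))"
    and h: "\<And>n. h (Suc n) < 0"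
  shows "\<bar>h n\<bar> \<le> g 0 * q n"
proof (cases n)
  case 0
  then show ?thesis
    using conv[of 0] g[of 0] q0 by simp
next
  case (Suc m)
  have split: "{..m} = insert 0 {1..m}"
    by auto
  have "g n = (\<Sum>k\<le>m. h k * q (Suc m - k)) + h n"
    using conv[of n] q0 Suc by simp
  also have "(\<Sum>k\<le>m. h k * q (Suc m - k)) = g 0 * q n + (\<Sum>k=1..m. h k * q (Suc m - k))"
    unfolding split using Suc conv[of 0] q0 by simp
  finally have "- h n = g 0 * q n + (\<Sum>k=1..m. h k * q (Suc m - k)) - g n"
    by simp
  moreover have "(\<Sum>k=1..m. h k * q (Suc m - k)) \<le> 0"
  proof (rule sum_nonpos)
    fix k assume "k \<in> {1..m}"
    then have "h k < 0"
      using h[of "k - 1"] by simp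
    then show "h k * q (Suc m - k) \<le> 0"
      using q[of "Suc m - k"] by (simp add: mult_le_0_iff)
  qed
  ultimately show ?thesis
    using h[of m] g[of n] Suc by simp
qed

section \<open>Behaviour of power series at the endpoint \<open>1\<close>\<close>

lemma summable_inverse_square: "summable (\<lambda>n. C / (real n + 1)\<^sup>2)"
  using summable_mult[OF inverse_squares_sums[THEN sums_summable], of C]
  by (simp add: inverse_eq_divide add.commute)

text \<open>Interpolating \<open>1 - x ^ n\<close> between the bounds \<open>1\<close> and
  \<open>n * (1 - x)\<close> costs half a power of \<open>n\<close>. The majorant then decays like a
  \<open>3/2\<close>-th inverse power and is summable, whereas the plain Bernoulli bound would leave
  a harmonic series.\<close>

lemma powser_defect_at_1:
  fixes c :: "nat \<Rightarrow> real"
  assumes c: "\<And>n. \<bar>c n\<bar> \<le> C / (real n + 1)\<^sup>2"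
  obtains D where "0 \<le> D"
    "\<And>x. x \<in> {0<..<1} \<Longrightarrow> \<bar>(\<Sum>n. c n) - (\<Sum>n. c n * x ^ n)\<bar> \<le> D * sqrt (1 - x)"
proof -
  have C: "0 \<le> C"
    using c[of 0] by simp
  have sumc: "summable c"
    using c by (intro summable_comparison_test'[OF summable_inverse_square[of C], of 0]) auto
  have eq: "1 / y powr (3 / 2) = sqrt y / y\<^sup>2" if "y > 0" for y :: real
  proof -
    have "y powr (3 / 2) = y * sqrt y"
      using that powr_add[of y 1 "1/2"] by (simp add: powr_half_sqrt)
    moreover have "y\<^sup>2 = sqrt y * (y * sqrt y)"
      using that by (simp add: power2_eq_square)
    ultimately show ?thesis
      using that by (metis mult.commute mult.right_neutral nonzero_divide_mult_cancel_left real_sqrt_gt_0_iff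
          less_irrefl)
  qed
  have "summable (\<lambda>n. C * (1 / (real (Suc n)) powr (3/2)))"
    using summable_Suc_iff[of "\<lambda>n. 1 / real n powr (3/2)"]
      summable_real_powr_iff[of "- (3/2)"]
    by (intro summable_mult) (simp add: powr_minus_divide)
  then have D: "summable (\<lambda>n. C * sqrt (real n + 1) / (real n + 1)\<^sup>2)"
    by (simp add: eq add.commute)
  show thesis
  proof (rule that[of "\<Sum>n. C * sqrt (real n + 1) / (real n + 1)\<^sup>2"])
    show "0 \<le> (\<Sum>n. C * sqrt (real n + 1) / (real n + 1)\<^sup>2)"
      using C by (intro suminf_nonneg D) simp
    fix x :: real assume x: "x \<in> {0<..<1}"
    have bound: "\<bar>c n * (1 - x ^ n)\<bar> \<le> C * sqrt (real n + 1) / (real n + 1)\<^sup>2 * sqrt (1 - x)" for n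
    proof -
      have xn: "0 \<le> 1 - x ^ n" "1 - x ^ n \<le> 1"
        using x by (auto simp: power_le_one)
      \<comment> \<open>A number in the unit interval dominates its square; this is where the square
        root comes from.\<close>
      have "(1 - x ^ n)\<^sup>2 \<le> 1 - x ^ n"
        using mult_left_mono[OF xn(2) xn(1)] by (simp add: power2_eq_square)
      also have "\<dots> \<le> real n * (1 - x)"
        using Bernoulli_inequality[of "x - 1" n] x by (simp add: algebra_simps)
      also have "\<dots> \<le> (real n + 1) * (1 - x)"
        using x by (intro mult_right_mono) auto
      finally have "(1 - x ^ n)\<^sup>2 \<le> (real n + 1) * (1 - x)" .
      then have "1 - x ^ n \<le> sqrt ((real n + 1) * (1 - x))"
        by (rule real_le_rsqrt)
      then have "\<bar>c n\<bar> * (1 - x ^ n) \<le> C / (real n + 1)\<^sup>2 * sqrt ((real n + 1) * (1 - x))"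
        using c[of n] xn by (intro mult_mono) auto
      then show ?thesis
        using xn by (simp add: abs_mult real_sqrt_mult)
    qed
    have "summable (\<lambda>n. c n * x ^ n)"
    proof (rule summable_comparison_test'[OF summable_inverse_square[of C], of 0])
      fix n
      have "\<bar>c n\<bar> * x ^ n \<le> \<bar>c n\<bar> * 1"
        using x by (intro mult_left_mono) (auto simp: power_le_one)
      then show "norm (c n * x ^ n) \<le> C / (real n + 1)\<^sup>2"
        using c[of n] x by (simp add: abs_mult)
    qed
    with sumc have "(\<Sum>n. c n) - (\<Sum>n. c n * x ^ n) = (\<Sum>n. c n * (1 - x ^ n))"
      by (simp add: suminf_diff algebra_simps)
    also have "\<bar>\<dots>\<bar> \<le> (\<Sum>n. C * sqrt (real n + 1) / (real n + 1)\<^sup>2 * sqrt (1 - x))"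
      by (rule norm_suminf_le[where f = "\<lambda>n. c n * (1 - x ^ n)", unfolded real_norm_def, OF bound]) (intro summable_mult2 D)
    also have "\<dots> = (\<Sum>n. C * sqrt (real n + 1) / (real n + 1)\<^sup>2) * sqrt (1 - x)"
      by (rule suminf_mult2[symmetric]) (rule D)
    finally show "\<bar>(\<Sum>n. c n) - (\<Sum>n. c n * x ^ n)\<bar> \<le>
      (\<Sum>n. C * sqrt (real n + 1) / (real n + 1)\<^sup>2) * sqrt (1 - x)" .
  qed
qed

text \<open>The M-test with the bounds \<open>norm (c n)\<close> includes the endpoint
  \<open>1\<close>, so boundary values are plain sums of coefficients.\<close>

lemma continuous_on_powser_unit:
  fixes c :: "nat \<Rightarrow> real"
  assumes "summable (\<lambda>n. norm (c n))"
  shows "continuous_on {0..1} (\<lambda>x. \<Sum>n. c n * x ^ n)"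
proof (rule uniform_limit_theorem)
  show "uniform_limit {0..1} (\<lambda>n x. \<Sum>i<n. c i * x ^ i) (\<lambda>x. \<Sum>n. c n * x ^ n) sequentially"
  proof (rule Weierstrass_m_test[OF _ assms])
    fix n and x :: real assume "x \<in> {0..1}"
    then have "\<bar>c n\<bar> * x ^ n \<le> \<bar>c n\<bar> * 1"
      by (intro mult_left_mono) (auto simp: power_le_one)
    then show "norm (c n * x ^ n) \<le> norm (c n)"
      using \<open>x \<in> {0..1}\<close> by (simp add: abs_mult)
  qed
qed (auto intro!: always_eventually continuous_intros)

lemma tendsto_powser_at_left_1:
  fixes c :: "nat \<Rightarrow> real"
  assumes "summable (\<lambda>n. norm (c n))"
  shows "((\<lambda>x. \<Sum>n. c n * x ^ n) \<longlongrightarrow> (\<Sum>n. c n)) (at_left 1)"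
proof -
  have "((\<lambda>x. \<Sum>n. c n * x ^ n) \<longlongrightarrow> (\<Sum>n. c n * 1 ^ n)) (at 1 within {0..1})"
    using continuous_on_powser_unit[OF assms] unfolding continuous_on_def by (rule bspec) simp
  moreover have "at 1 within {0..1} = at_left (1::real)"
    by (rule at_within_Icc_at_left) simp
  ultimately show ?thesis
    by simp
qed

section \<open>Monotonicity, range and chords for series with positive coefficients\<close>

lemma powser_strict_mono:
  fixes e :: "nat \<Rightarrow> real"
  assumes e: "\<And>n. 0 < e (Suc n)"
    and sums: "\<And>x. \<bar>x\<bar> < 1 \<Longrightarrow> summable (\<lambda>n. e n * x ^ n)"
    and "0 \<le> x" "x < y" "y < 1"
  shows "(\<Sum>n. e n * x ^ n) < (\<Sum>n. e n * y ^ n)"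
proof -
  have sm: "summable (\<lambda>n. e n * x ^ n)" "summable (\<lambda>n. e n * y ^ n)"
    using assms(3-5) by (auto intro!: sums)
  have "0 < (\<Sum>n. e n * y ^ n - e n * x ^ n)"
  proof (rule suminf_pos2[where i = 1])
    show "0 \<le> e n * y ^ n - e n * x ^ n" for n
      using e[of "n - 1"] assms(3-5)
      by (cases n) (auto intro!: mult_left_mono mult_mono power_mono)
    \<comment> \<open>The constant terms cancel, whatever the sign of \<open>e 0\<close>, and the
      linear term alone makes the inequality strict.\<close>
    show "0 < e 1 * y ^ 1 - e 1 * x ^ 1"
      using e[of 0] assms(3-5) by simp
  qed (rule summable_diff[OF sm(2,1)])
  then show ?thesis
    using suminf_diff[OF sm(2,1)] by simp
qed

lemma powser_less_limit:
  fixes e :: "nat \<Rightarrow> real"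
  assumes e: "\<And>n. 0 < e (Suc n)"
    and sums: "\<And>x. \<bar>x\<bar> < 1 \<Longrightarrow> summable (\<lambda>n. e n * x ^ n)"
    and lim: "((\<lambda>x. \<Sum>n. e n * x ^ n) \<longlongrightarrow> L) (at_left 1)"
    and x: "0 \<le> x" "x < 1"
  shows "(\<Sum>n. e n * x ^ n) < L"
proof -
  \<comment> \<open>Limits preserve only weak inequalities; the detour through \<open>y\<close>
    restores strictness.\<close>
  obtain y where y: "x < y" "y < 1"
    using dense x by blast
  have "eventually (\<lambda>z. (\<Sum>n. e n * y ^ n) \<le> (\<Sum>n. e n * z ^ n)) (at_left 1)"
    using eventually_at_left_real[OF y(2)]
    by eventually_elim (use powser_strict_mono[OF e sums] x y in \<open>auto intro!: less_imp_le\<close>)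
  from tendsto_lowerbound[OF lim this] have "(\<Sum>n. e n * y ^ n) \<le> L"
    by simp
  with powser_strict_mono[OF e sums x(1) y] show ?thesis
    by simp
qed

text \<open>Strict monotonicity and the limit confine the values to the open interval, and the
  intermediate value theorem on \<open>{0..y}\<close> attains each of them.\<close>

lemma powser_image:
  fixes e :: "nat \<Rightarrow> real"
  assumes e: "\<And>n. 0 < e (Suc n)"
    and sums: "\<And>x. \<bar>x\<bar> < 1 \<Longrightarrow> summable (\<lambda>n. e n * x ^ n)"
    and lim: "((\<lambda>x. \<Sum>n. e n * x ^ n) \<longlongrightarrow> L) (at_left 1)"
  shows "(\<lambda>x. \<Sum>n. e n * x ^ n) ` {0<..<1} = {e 0<..<L}"
proof (intro equalityI subsetI)
  fix v assume "v \<in> (\<lambda>x. \<Sum>n. e n * x ^ n) ` {0<..<1}"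
  then obtain x where x: "0 < x" "x < 1" "v = (\<Sum>n. e n * x ^ n)"
    by auto
  with powser_strict_mono[OF e sums, of 0 x] powser_less_limit[OF e sums lim, of x]
  show "v \<in> {e 0<..<L}"
    by simp
next
  fix v assume v: "v \<in> {e 0<..<L}"
  have "eventually (\<lambda>x. v < (\<Sum>n. e n * x ^ n)) (at_left 1)"
    using order_tendstoD(1)[OF lim] v by simp
  moreover have "eventually (\<lambda>x::real. x \<in> {0<..<1}) (at_left 1)"
    by (rule eventually_at_left_real) simp
  ultimately obtain y where y: "y \<in> {0<..<1}" "v < (\<Sum>n. e n * y ^ n)"
    using eventually_happens[OF eventually_conj] trivial_limit_at_left_real by blast
  have cont: "continuous_on {0..y} (\<lambda>x. \<Sum>n. e n * x ^ n)"
  proof (intro continuous_at_imp_continuous_on ballI)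
    fix x assume "x \<in> {0..y}"
    then show "isCont (\<lambda>x. \<Sum>n. e n * x ^ n) x"
      \<comment> \<open>\<open>isCont_powser\<close> asks for a point of convergence beyond
        \<open>x\<close>; the midpoint of \<open>y\<close> and \<open>1\<close> serves.\<close>
      using y sums[of "(1 + y) / 2"] by (intro isCont_powser[of _ "(1 + y) / 2"]) auto
  qed
  have "\<exists>x\<ge>0. x \<le> y \<and> (\<Sum>n. e n * x ^ n) = v"
    using v y by (intro IVT' cont) auto
  then obtain x where x: "0 \<le> x" "x \<le> y" "(\<Sum>n. e n * x ^ n) = v"
    by blast
  moreover have "x \<noteq> 0"
    using x(3) v by auto
  ultimately show "v \<in> (\<lambda>x. \<Sum>n. e n * x ^ n) ` {0<..<1}"
    using y by (intro image_eqI[of _ _ x]) auto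
qed

text \<open>The difference quotient at \<open>0\<close> is again a power series with positive coefficients.\<close>
lemma powser_less_chord:
  fixes e :: "nat \<Rightarrow> real"
  assumes e: "\<And>n. 0 < e (Suc n)"
    and sums: "\<And>x. \<bar>x\<bar> < 1 \<Longrightarrow> summable (\<lambda>n. e n * x ^ n)"
    and lim: "((\<lambda>x. \<Sum>n. e n * x ^ n) \<longlongrightarrow> L) (at_left 1)"
    and x: "0 < x" "x < 1"
  shows "(\<Sum>n. e n * x ^ n) < e 0 + (L - e 0) * x"
proof -
  have shift: "summable (\<lambda>n. e (Suc n) * z ^ n) \<and>
      (\<Sum>n. e n * z ^ n) = e 0 + z * (\<Sum>n. e (Suc n) * z ^ n)" if "\<bar>z\<bar> < 1" for z
  proof
    have s: "summable (\<lambda>n. e n * z ^ n)"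
      by (rule sums) (rule that)
    show sS: "summable (\<lambda>n. e (Suc n) * z ^ n)"
      using powser_split_head(3)[OF s] .
    show "(\<Sum>n. e n * z ^ n) = e 0 + z * (\<Sum>n. e (Suc n) * z ^ n)"
      using powser_split_head(1)[OF s] by (simp add: mult.commute)
  qed
  have lt: "\<bar>z\<bar> < 1" if "z \<in> {0<..<1}" for z :: real
    using that by auto
  have ev: "eventually (\<lambda>z::real. z \<in> {0<..<1}) (at_left 1)"
    by (rule eventually_at_left_real) simp
  have "((\<lambda>z. ((\<Sum>n. e n * z ^ n) - e 0) / z) \<longlongrightarrow> (L - e 0) / 1) (at_left 1)"
    by (intro tendsto_intros lim) simp_all
  moreover have "eventually (\<lambda>z. ((\<Sum>n. e n * z ^ n) - e 0) / z = (\<Sum>n. e (Suc n) * z ^ n)) (at_left 1)"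
    using ev by eventually_elim (use shift in auto)
  ultimately have "((\<lambda>z. \<Sum>n. e (Suc n) * z ^ n) \<longlongrightarrow> L - e 0) (at_left 1)"
    using tendsto_cong by force
  from powser_less_limit[OF _ _ this, of x] have "(\<Sum>n. e (Suc n) * x ^ n) < L - e 0"
    using e shift x by auto
  then have "x * (\<Sum>n. e (Suc n) * x ^ n) < x * (L - e 0)"
    using x by simp
  then show ?thesis
    using shift[of x] x by (simp add: mult.commute)
qed

section \<open>A series for differences of the digamma function\<close>

lemma Beta_add_nat:
  fixes a z :: real
  assumes "0 < a" "0 < z"
  shows "Beta a (z + real n) = Beta a z * pochhammer z n / pochhammer (a + z) n"
proof (induction n)
  case (Suc n)
  have "z + real n \<notin> \<int>\<^sub>\<le>\<^sub>0"
    using assms by (auto elim!: nonpos_Ints_cases)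
  from Beta_plus1_right[OF this, of a]
  have "Beta a (z + real (Suc n)) = (z + real n) * Beta a (z + real n) / (a + z + real n)"
    using assms by (simp add: field_simps)
  then show ?case
    using Suc by (simp add: pochhammer_Suc field_simps)
qed simp

text \<open>Up to the factor \<open>Beta a z\<close> this is a quotient of
  \<open>Gamma_series'\<close> terms, in which the powers of \<open>n\<close> cancel and whose
  limits are Gamma values.\<close>

lemma Gauss_summation_tendsto:
  fixes a z :: real
  assumes "0 < a" "0 < z"
  shows "(\<lambda>n. real n * (pochhammer a n / fact n) * Beta a (z + real n)) \<longlonglongrightarrow> 1"
proof -
  have nz: "Gamma a \<noteq> 0" "Gamma z \<noteq> 0" "Gamma (a + z) \<noteq> 0"
    using assms by (auto simp: Gamma_eq_zero_iff elim!: nonpos_Ints_cases)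
  have "(\<lambda>n. Beta a z * (Gamma_series' (a + z) n / (Gamma_series' z n * Gamma_series' a n)))
      \<longlonglongrightarrow> Beta a z * (Gamma (a + z) / (Gamma z * Gamma a))"
    using nz by (intro tendsto_intros Gamma_series'_LIMSEQ) auto
  moreover have "Beta a z * (Gamma (a + z) / (Gamma z * Gamma a)) = 1"
    using nz by (simp add: Beta_def)
  moreover have "Beta a z * (Gamma_series' (a + z) n / (Gamma_series' z n * Gamma_series' a n)) =
      real n * (pochhammer a n / fact n) * Beta a (z + real n)" if "n > 0" for n
  proof -
    have pos: "pochhammer a n > 0" "pochhammer z n > 0" "pochhammer (a + z) n > 0"
      using assms by (auto intro!: pochhammer_pos)
    \<comment> \<open>\<open>Gamma_series'\<close> contains \<open>fact (n - 1)\<close> in place of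
      \<open>fact n\<close>; this accounts for the factor \<open>real n\<close>.\<close>
    have "(fact n :: real) = real n * fact (n - 1)"
      using that by (simp add: fact_reduce)
    then show ?thesis
      unfolding Beta_add_nat[OF assms] Gamma_series'_def
      using pos that by (simp add: field_simps exp_add)
  qed
  ultimately show ?thesis
    using Lim_transform_eventually[OF _ eventually_mono[OF eventually_gt_at_top[of 0]]]
    by (metis (no_types, lifting))
qed

text \<open>Gauss's theorem for \<open>F(a, z; a + z + 1; 1)\<close>, up to the factor
  \<open>Beta (a + 1) z\<close>. The partial sums have a closed form, and its limit is known from
  \<open>Gauss_summation_tendsto\<close>.\<close>

lemma Gauss_summation:
  fixes a z :: real
  assumes "0 < a" "0 < z"
  shows "(\<lambda>n. pochhammer a n / fact n * Beta (a + 1) (z + real n)) sums (1 / z)"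
proof -
  have partial: "(\<Sum>n<N. pochhammer a n / fact n * Beta (a + 1) (z + real n)) =
      real N * (pochhammer a N / fact N) * Beta a (z + real N) / z" for N
  proof (induction N)
    case (Suc N)
    have ni: "z + real N \<notin> \<int>\<^sub>\<le>\<^sub>0" "a \<notin> \<int>\<^sub>\<le>\<^sub>0"
      using assms by (auto elim!: nonpos_Ints_cases)
    define B where "B = Beta a (z + real N)"
    define c where "c = pochhammer a N / fact N"
    have "Beta a (z + real (Suc N)) = (z + real N) * B / (a + z + real N)"
      using Beta_plus1_right[OF ni(1), of a] assms by (simp add: field_simps B_def)
    moreover have "Beta (a + 1) (z + real N) = a * B / (a + z + real N)"
      using Beta_plus1_left[OF ni(2), of "z + real N"] assms by (simp add: field_simps B_def)
    moreover have "real (Suc N) * (pochhammer a (Suc N) / fact (Suc N)) = (a + real N) * c"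
      by (simp add: pochhammer_Suc c_def del: of_nat_Suc)
    \<comment> \<open>Comes down to
      \<open>N * (a + z + N) + a * z = (a + N) * (z + N)\<close>.\<close>
    moreover have "real N * c * B / z + c * (a * B / (a + z + real N)) =
        (a + real N) * c * ((z + real N) * B / (a + z + real N)) / z"
      using assms by (simp add: field_simps)
    ultimately show ?case
      using Suc by (simp only: sum.lessThan_Suc B_def c_def)
  qed simp
  show ?thesis
    unfolding sums_def partial
    using tendsto_divide[OF Gauss_summation_tendsto[OF assms] tendsto_const[of z]] assms by simp
qed

text \<open>
  Both sides satisfy \<open>S y - S (y + 1) = 1 / y - 1 / (y + d)\<close> and vanish at infinity.
\<close>
lemma Digamma_diff_sums:
  fixes a y d :: real
  assumes "0 < a" "0 < y" "0 \<le> d" "d \<le> 1"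
  shows "(\<lambda>n. pochhammer a n / fact n * (Beta a (y + real n) - Beta a (y + d + real n))) sums
    (Digamma (y + d) - Digamma y)"
proof -
  define c where "c n = pochhammer a n / fact n" for n
  define D where "D y n = c n * (Beta a (y + real n) - Beta a (y + d + real n))" for y n
  have c: "c n \<ge> 0" for n
    using assms by (simp add: c_def pochhammer_nonneg)
  have split: "Beta a (z + real n) - Beta a (z + 1 + real n) = Beta (a + 1) (z + real n)"
    if "0 < z" for z n
  proof -
    have "a \<notin> \<int>\<^sub>\<le>\<^sub>0" "z + real n \<notin> \<int>\<^sub>\<le>\<^sub>0"
      using that assms by (auto elim!: nonpos_Ints_cases)
    from Beta_plus1_plus1[OF this] show ?thesis
      by (simp add: add_ac)
  qed
  \<comment> \<open>As \<open>Beta\<close> decreases in its second argument and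
    \<open>d \<le> 1\<close>, the difference is at most that of a full unit step, and Gauss's series
    sums those to \<open>1 / z\<close>.\<close>
  have D: "0 \<le> D z n \<and> D z n \<le> c n * Beta (a + 1) (z + real n)" if "0 < z" for z n
    unfolding split[OF that, symmetric] D_def using assms that c
    by (auto intro!: mult_nonneg_nonneg mult_left_mono Beta_real_mono diff_left_mono)
  have T: "(\<lambda>n. c n * Beta (a + 1) (z + real n)) sums (1 / z)" if "0 < z" for z
    unfolding c_def by (rule Gauss_summation) (use that assms in auto)
  have sumD: "summable (D z)" if "0 < z" for z
    using D[OF that] by (intro summable_comparison_test'[OF sums_summable[OF T[OF that]], of 0]) auto
  define S where "S z = suminf (D z)" for z
  have S_bound: "0 \<le> S z \<and> S z \<le> 1 / z" if "0 < z" for z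
  proof
    show "0 \<le> S z"
      unfolding S_def using D[OF that] by (intro suminf_nonneg sumD that) auto
    have "S z \<le> (\<Sum>n. c n * Beta (a + 1) (z + real n))"
      unfolding S_def using D[OF that] sums_summable[OF T[OF that]]
      by (intro suminf_le sumD that) auto
    then show "S z \<le> 1 / z"
      using sums_unique[OF T[OF that]] by simp
  qed
  have S_step: "S z = (inverse z - inverse (z + d)) + S (z + 1)" if "0 < z" for z
  proof -
    \<comment> \<open>Using \<open>split\<close> at \<open>z\<close> and at \<open>z + d\<close>
      leaves the difference of two Gauss series.\<close>
    have "D z n - D (z + 1) n = c n * Beta (a + 1) (z + real n) - c n * Beta (a + 1) (z + d + real n)" for n
      using split[of z n] split[of "z + d" n] that assms unfolding D_def
      by (simp add: algebra_simps)
    moreover have "(\<lambda>n. D z n - D (z + 1) n) sums (S z - S (z + 1))"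
      unfolding S_def using that by (intro sums_diff summable_sums sumD) auto
    moreover have "(\<lambda>n. c n * Beta (a + 1) (z + real n) - c n * Beta (a + 1) (z + d + real n)) sums
        (1 / z - 1 / (z + d))"
      using that assms by (intro sums_diff T) auto
    ultimately have "S z - S (z + 1) = 1 / z - 1 / (z + d)"
      using sums_unique2 by force
    then show ?thesis
      by (simp add: inverse_eq_divide)
  qed
  have S_sum: "S y = (\<Sum>m<M. inverse (y + real m) - inverse (y + d + real m)) + S (y + real M)" for M
  proof (induction M)
    case (Suc M)
    then show ?case
      using S_step[of "y + real M"] assms by (simp add: add_ac)
  qed simp
  have "(\<lambda>M. 1 / (y + real M)) \<longlonglongrightarrow> 0"
    by real_asymp
  moreover have "0 \<le> S (y + real M)" "S (y + real M) \<le> 1 / (y + real M)" for M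
    using S_bound[of "y + real M"] assms by auto
  ultimately have "(\<lambda>M. S (y + real M)) \<longlonglongrightarrow> 0"
    using tendsto_sandwich[of "\<lambda>_. 0" "\<lambda>M. S (y + real M)" sequentially "\<lambda>M. 1 / (y + real M)" 0]
    by simp
  then have "(\<lambda>M. S y - S (y + real M)) \<longlonglongrightarrow> S y - 0"
    by (intro tendsto_intros)
  then have 1: "(\<lambda>M. \<Sum>m<M. inverse (y + real m) - inverse (y + d + real m)) \<longlonglongrightarrow> S y"
  proof -
    have "S y - S (y + real M) = (\<Sum>m<M. inverse (y + real m) - inverse (y + d + real m))" for M
      using S_sum[of M] by linarith
    with \<open>(\<lambda>M. S y - S (y + real M)) \<longlonglongrightarrow> S y - 0\<close> show ?thesis
      by (simp only: diff_zero)
  qed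
  \<comment> \<open>The logarithms in the limit formulas for the two digamma values cancel.\<close>
  have "(\<lambda>M. (of_real (ln (real M)) - (\<Sum>m<M. inverse (y + d + of_nat m))) -
      (of_real (ln (real M)) - (\<Sum>m<M. inverse (y + of_nat m)))) \<longlonglongrightarrow> Digamma (y + d) - Digamma y"
    using assms by (intro tendsto_diff Digamma_LIMSEQ) auto
  then have "(\<lambda>M. \<Sum>m<M. inverse (y + real m) - inverse (y + d + real m)) \<longlonglongrightarrow> Digamma (y + d) - Digamma y"
    by (simp add: sum_subtractf)
  with 1 have "S y = Digamma (y + d) - Digamma y"
    using LIMSEQ_unique by blast
  with summable_sums[OF sumD[OF assms(2)]] have "D y sums (Digamma (y + d) - Digamma y)"
    by (simp only: S_def)
  then show ?thesis
    unfolding D_def[abs_def] c_def .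
qed

section \<open>Hypergeometric coefficients\<close>

definition hyp_coeff :: "real \<Rightarrow> real \<Rightarrow> real \<Rightarrow> nat \<Rightarrow> real" where
  "hyp_coeff a b c n = pochhammer a n * pochhammer b n / (pochhammer c n * fact n)"

lemma hyp2F1_eq: "hyp2F1 a b c x = (\<Sum>n. hyp_coeff a b c n * x ^ n)"
  by (simp add: hyp2F1_def hyp_coeff_def)

lemma hyp_coeff_0 [simp]: "hyp_coeff a b c 0 = 1"
  by (simp add: hyp_coeff_def)

lemma hyp_coeff_Suc:
  "hyp_coeff a b c (Suc n) =
    hyp_coeff a b c n * ((a + real n) * (b + real n) / ((c + real n) * (1 + real n)))"
  by (simp add: hyp_coeff_def pochhammer_Suc mult_ac)

lemma hyp_coeff_pos: "0 < a \<Longrightarrow> 0 < b \<Longrightarrow> 0 < c \<Longrightarrow> 0 < hyp_coeff a b c n"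
  by (simp add: hyp_coeff_def pochhammer_pos)

text \<open>The last two hypotheses compare \<open>(a + n) * (b + n)\<close> with
  \<open>(c + n) * (1 + n)\<close> coefficient by coefficient, so the ratio of successive terms is
  at most \<open>1\<close>.\<close>

lemma hyp_coeff_le_1:
  assumes "0 < a" "0 < b" "0 < c" "a * b \<le> c" "a + b \<le> c + 1"
  shows "hyp_coeff a b c n \<le> 1"
proof (induction n)
  case (Suc n)
  have "(a + b) * real n \<le> (c + 1) * real n"
    using assms by (intro mult_right_mono) auto
  moreover have "0 < (c + real n) * (1 + real n)"
    using assms by (intro mult_pos_pos) auto
  ultimately have "(a + real n) * (b + real n) / ((c + real n) * (1 + real n)) \<le> 1"
    using assms by (subst divide_le_eq_1_pos) (auto simp: algebra_simps)
  with Suc show ?case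
    unfolding hyp_coeff_Suc using assms by (intro mult_le_one) auto
qed simp

lemma summable_hyp:
  assumes "0 < a" "0 < b" "0 < c" "a * b \<le> c" "a + b \<le> c + 1" "\<bar>x\<bar> < 1"
  shows "summable (\<lambda>n. norm (hyp_coeff a b c n * x ^ n))"
  using hyp_coeff_le_1[OF assms(1-5)] hyp_coeff_pos[OF assms(1-3)] assms(6)
  by (intro summable_powser_bounded[of _ 1]) (auto simp: abs_of_pos)

lemma hyp_coeff_add_1:
  assumes "0 < c"
  shows "hyp_coeff a b (c + 1) n = hyp_coeff a b c n * (c / (c + real n))"
proof (induction n)
  case (Suc n)
  show ?case
    unfolding hyp_coeff_Suc Suc using assms by (simp add: field_simps)
qed (use assms in simp)

text \<open>
  The coefficient form of \<open>(1 - x) F'(a, b; a + b; x) = a b / (a + b) F(a, b; a + b + 1; x)\<close>.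
\<close>
lemma hyp_coeff_zero_balanced:
  assumes "0 < a + b"
  shows "real (Suc n) * hyp_coeff a b (a + b) (Suc n) - real n * hyp_coeff a b (a + b) n =
    a * b / (a + b) * hyp_coeff a b (a + b + 1) n"
proof -
  have ne: "a + b + real n \<noteq> 0"
    using assms by (smt (verit) of_nat_0_le_iff)
  have "real (Suc n) * hyp_coeff a b (a + b) (Suc n) - real n * hyp_coeff a b (a + b) n =
      hyp_coeff a b (a + b) n * ((a + real n) * (b + real n) / (a + b + real n) - real n)"
  proof -
    have "k * (X * (Y / (Z * k))) = X * (Y / Z)" if "k \<noteq> 0" for k X Y Z :: real
      using that by simp
    from this[of "1 + real n"] show ?thesis
      unfolding hyp_coeff_Suc by (simp add: right_diff_distrib mult.commute)
  qed
  also have "(a + real n) * (b + real n) / (a + b + real n) - real n = a * b / (a + b + real n)"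
    using ne by (simp add: field_simps)
  finally show ?thesis
    unfolding hyp_coeff_add_1[OF assms] using assms by simp
qed

text \<open>The ratio of successive coefficients factors into \<open>(a + n) / (1 + n)\<close> and
  \<open>(b + n) / (c + n)\<close>, which are nondecreasing in \<open>n\<close> because
  \<open>a \<le> 1\<close> and \<open>b \<le> c\<close>.\<close>

lemma hyp_coeff_log_convex:
  assumes "0 < a" "a \<le> 1" "0 < b" "b \<le> c" "m \<le> n"
  shows "hyp_coeff a b c (Suc m) * hyp_coeff a b c n \<le> hyp_coeff a b c m * hyp_coeff a b c (Suc n)"
proof -
  have ratio: "(s + real m) / (t + real m) \<le> (s + real n) / (t + real n)" if "0 < s" "s \<le> t" for s t
  proof -
    have "s * real n + t * real m \<le> s * real m + t * real n"
      using mult_nonneg_nonneg[of "t - s" "real n - real m"] that assms by (simp add: algebra_simps)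
    then show ?thesis
      using that by (simp add: divide_simps algebra_simps)
  qed
  have "(a + real m) * (b + real m) / ((c + real m) * (1 + real m)) =
      (a + real m) / (1 + real m) * ((b + real m) / (c + real m))"
    by simp
  also have "\<dots> \<le> (a + real n) / (1 + real n) * ((b + real n) / (c + real n))"
    using assms by (intro mult_mono ratio) auto
  also have "\<dots> = (a + real n) * (b + real n) / ((c + real n) * (1 + real n))"
    by simp
  finally have "hyp_coeff a b c m * hyp_coeff a b c n *
        ((a + real m) * (b + real m) / ((c + real m) * (1 + real m))) \<le>
      hyp_coeff a b c m * hyp_coeff a b c n *
        ((a + real n) * (b + real n) / ((c + real n) * (1 + real n)))"
    using hyp_coeff_pos[of a b c m] hyp_coeff_pos[of a b c n] assms
    by (intro mult_left_mono) auto
  then show ?thesis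
    unfolding hyp_coeff_Suc by (simp only: mult_ac)
qed

text \<open>Gives the values at \<open>1\<close> of \<open>G\<close>, with \<open>b = 1 - a\<close>,
  and of \<open>Q\<close>, with \<open>b = 3/2 - a\<close>.\<close>

lemma Gauss_hyp_sums:
  assumes "0 < a" "0 < b"
  shows "hyp_coeff a b (a + b + 1) sums (1 / (b * Beta (a + 1) b))"
proof -
  have "Beta (a + 1) b > 0"
    using assms by (simp add: Beta_def Gamma_real_pos)
  moreover have "pochhammer a n / fact n * Beta (a + 1) (b + real n) =
      hyp_coeff a b (a + b + 1) n * Beta (a + 1) b" for n
    using assms by (subst Beta_add_nat) (simp_all add: hyp_coeff_def ac_simps)
  ultimately show ?thesis
    using sums_divide[OF Gauss_summation[OF assms], of "Beta (a + 1) b"] by simp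
qed

section \<open>Coefficients of \<open>G / Q\<close> and of \<open>f6\<close>\<close>

text \<open>Division of formal power series provides the convolution identity before any question of
  convergence arises; the divisor has constant term \<open>1\<close>.\<close>

definition quot_coeff :: "real \<Rightarrow> nat \<Rightarrow> real" where
  "quot_coeff a =
    fps_nth (Abs_fps (hyp_coeff a (1 - a) 2) / Abs_fps (hyp_coeff a (3 / 2 - a) (5 / 2)))"

text \<open>These are the coefficients of \<open>U - h P\<close>; the factor \<open>pi / 2\<close>
  of \<open>f6\<close> is left out.\<close>

definition f6_coeff :: "real \<Rightarrow> nat \<Rightarrow> real" where
  "f6_coeff a n = hyp_coeff a (1 - a) 1 n -
    1 / alpha_const a * (\<Sum>k\<le>n. quot_coeff a k * hyp_coeff a (3 / 2 - a) (3 / 2) (n - k))"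

lemma quot_coeff_fps:
  "Abs_fps (quot_coeff a) * Abs_fps (hyp_coeff a (3 / 2 - a) (5 / 2)) = Abs_fps (hyp_coeff a (1 - a) 2)"
  unfolding quot_coeff_def by (simp add: fps_nth_inverse fps_divide_unit mult.assoc inverse_mult_eq_1)

lemma quot_coeff_conv:
  "hyp_coeff a (1 - a) 2 n = (\<Sum>k\<le>n. quot_coeff a k * hyp_coeff a (3 / 2 - a) (5 / 2) (n - k))"
  using arg_cong[OF quot_coeff_fps[of a], of "\<lambda>f. fps_nth f n"]
  by (simp add: fps_mult_nth atLeast0AtMost)

context
  fixes a :: real
  assumes a: "0 < a" "a < 1"
begin

lemma alpha_pos: "0 < alpha_const a"
  using a by (simp add: alpha_const_def)

lemma quot_coeff_0: "quot_coeff a 0 = 1"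
  using quot_coeff_conv[of a 0] by simp

text \<open>The coefficient ratios of \<open>G\<close> and \<open>Q\<close> share the factor
  \<open>(a + n) / (1 + n)\<close>. Cross-multiplying the remaining factors leaves the difference
  \<open>1/2 + a/2\<close>, which is positive and independent of \<open>n\<close>.\<close>

lemma quot_coeff_neg: "quot_coeff a (Suc n) < 0"
proof (rule quotient_coeffs_neg[where q = "hyp_coeff a (3 / 2 - a) (5 / 2)" and g = "hyp_coeff a (1 - a) 2"])
  fix n :: nat
  let ?g = "hyp_coeff a (1 - a) 2" and ?q = "hyp_coeff a (3 / 2 - a) (5 / 2)"
  have "(1 - a + real n) * (5 / 2 + real n) < (3 / 2 - a + real n) * (2 + real n)"
  proof -
    have "(3 / 2 - a + real n) * (2 + real n) - (1 - a + real n) * (5 / 2 + real n) = 1 / 2 + a / 2"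
      by (simp add: field_simps)
    then show ?thesis
      using a by linarith
  qed
  moreover have "x / y < z / w" if "x * w < z * y" "0 < y" "0 < w" for x y z w :: real
    using that by (simp add: divide_simps mult_ac)
  ultimately have "(1 - a + real n) / (2 + real n) < (3 / 2 - a + real n) / (5 / 2 + real n)"
    by simp
  then have "(a + real n) / (1 + real n) * ((1 - a + real n) / (2 + real n)) <
      (a + real n) / (1 + real n) * ((3 / 2 - a + real n) / (5 / 2 + real n))"
    using a by (intro mult_strict_left_mono) auto
  then have "(a + real n) * (1 - a + real n) / ((2 + real n) * (1 + real n)) <
      (a + real n) * (3 / 2 - a + real n) / ((5 / 2 + real n) * (1 + real n))"
    by (simp add: ac_simps)
  moreover have "0 < ?g n * ?q n"
    using a by (intro mult_pos_pos hyp_coeff_pos) auto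
  ultimately show "?g (Suc n) * ?q n < ?g n * ?q (Suc n)"
    unfolding hyp_coeff_Suc using mult_strict_left_mono by (fastforce simp: mult_ac)
qed (use a in \<open>auto intro!: hyp_coeff_pos hyp_coeff_log_convex quot_coeff_conv\<close>)

lemma quot_coeff_bound: "\<bar>quot_coeff a n\<bar> \<le> hyp_coeff a (3 / 2 - a) (5 / 2) n"
  using quotient_coeffs_bound[OF _ _ _ quot_coeff_conv quot_coeff_neg, of n] a
  by (simp add: hyp_coeff_pos less_imp_le)

text \<open>\<open>alpha_const a\<close> is the ratio of the constants that
  \<open>hyp_coeff_zero_balanced\<close> yields for \<open>P\<close> and for \<open>U\<close>; this
  is why \<open>U' / P'\<close> equals \<open>G / Q\<close> divided by
  \<open>alpha_const a\<close>.\<close>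

lemma alpha_coeff: "1 / alpha_const a * (a * (3 / 2 - a) / (3 / 2)) = a * (1 - a)"
  using a by (simp add: alpha_const_def field_simps)

text \<open>
  The formal counterpart of \<open>f' = - h' P\<close>, where \<open>f = U - h P\<close> and \<open>h = U' / P'\<close>.
\<close>
lemma f6_coeff_Suc:
  "real (Suc n) * f6_coeff a (Suc n) = - (1 / alpha_const a) *
    (\<Sum>k\<le>n. real (Suc k) * quot_coeff a (Suc k) * hyp_coeff a (3 / 2 - a) (3 / 2) (n - k))"
proof -
  define U P G Q H E where "U = Abs_fps (hyp_coeff a (1 - a) 1)"
    and "P = Abs_fps (hyp_coeff a (3 / 2 - a) (3 / 2))"
    and "G = Abs_fps (hyp_coeff a (1 - a) 2)"
    and "Q = Abs_fps (hyp_coeff a (3 / 2 - a) (5 / 2))"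
    and "H = Abs_fps (quot_coeff a)" and "E = Abs_fps (f6_coeff a)"
  define k where "k = fps_const (1 / alpha_const a)"
  define l where "l = fps_const (a * (3 / 2 - a) / (3 / 2))"
  have E: "E = U - k * (H * P)"
  proof (rule fps_ext)
    fix n
    have "fps_nth (H * P) n = (\<Sum>k\<le>n. quot_coeff a k * hyp_coeff a (3 / 2 - a) (3 / 2) (n - k))"
      by (simp add: fps_mult_nth H_def P_def atLeast0AtMost)
    then show "fps_nth E n = fps_nth (U - k * (H * P)) n"
      by (simp add: E_def U_def k_def f6_coeff_def)
  qed
  \<comment> \<open>Multiplication by \<open>1 - fps_X\<close> takes first differences of
    coefficients, the form of \<open>hyp_coeff_zero_balanced\<close>.\<close>
  have zero_balanced: "(1 - fps_X) * fps_deriv (Abs_fps (hyp_coeff b c (b + c))) =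
      fps_const (b * c / (b + c)) * Abs_fps (hyp_coeff b c (b + c + 1))" if "0 < b + c" for b c
  proof (rule fps_ext)
    fix m
    show "fps_nth ((1 - fps_X) * fps_deriv (Abs_fps (hyp_coeff b c (b + c)))) m =
        fps_nth (fps_const (b * c / (b + c)) * Abs_fps (hyp_coeff b c (b + c + 1))) m"
      using hyp_coeff_zero_balanced[OF that, of m]
      by (cases m) (simp_all add: left_diff_distrib)
  qed
  have U: "(1 - fps_X) * fps_deriv U = k * l * G"
    using zero_balanced[of a "1 - a"] a unfolding U_def G_def k_def l_def
    by (simp only: fps_const_mult alpha_coeff) simp
  have P: "(1 - fps_X) * fps_deriv P = l * Q"
    using zero_balanced[of a "3 / 2 - a"] a unfolding P_def Q_def l_def by simp
  have HQ: "H * Q = G"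
    unfolding H_def Q_def G_def by (rule quot_coeff_fps)
  have k': "fps_deriv k = 0"
    by (simp add: k_def)
  have "(1 - fps_X) * fps_deriv E = (1 - fps_X) * fps_deriv U -
      k * H * ((1 - fps_X) * fps_deriv P) - (1 - fps_X) * (k * (fps_deriv H * P))"
    unfolding E by (simp add: k' algebra_simps)
  \<comment> \<open>By \<open>HQ\<close> the first two terms both equal \<open>k * l * G\<close> and
    cancel.\<close>
  also have "\<dots> = (1 - fps_X) * (- (k * (fps_deriv H * P)))"
    unfolding U P HQ[symmetric] by (simp add: algebra_simps)
  \<comment> \<open>The factor \<open>1 - fps_X\<close> has constant coefficient \<open>1\<close>,
    so it is nonzero and can be cancelled.\<close>
  finally have "fps_deriv E = - (k * (fps_deriv H * P))"
    by (subst (asm) mult_cancel_left) (auto simp: fps_eq_iff dest: spec[of _ 0])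
  from arg_cong[OF this, of "\<lambda>f. fps_nth f n"] show ?thesis
    unfolding k_def fps_neg_nth fps_mult_left_const_nth fps_mult_nth[of "fps_deriv H" P]
    by (simp add: E_def H_def P_def atLeast0AtMost)
qed

text \<open>Each summand in \<open>f6_coeff_Suc\<close> has exactly one negative factor, and the
  factor in front of the sum is negative too.\<close>

lemma f6_coeff_Suc_pos: "0 < f6_coeff a (Suc n)"
proof -
  have "0 < (\<Sum>k\<le>n. - (real (Suc k) * quot_coeff a (Suc k) * hyp_coeff a (3 / 2 - a) (3 / 2) (n - k)))"
    using a quot_coeff_neg hyp_coeff_pos[of a "3 / 2 - a" "3 / 2"]
    by (intro sum_pos) (auto simp: mult_less_0_iff simp del: of_nat_Suc)
  then have "(\<Sum>k\<le>n. real (Suc k) * quot_coeff a (Suc k) * hyp_coeff a (3 / 2 - a) (3 / 2) (n - k)) < 0"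
    by (simp add: sum_negf)
  then have "0 < real (Suc n) * f6_coeff a (Suc n)"
    unfolding f6_coeff_Suc using alpha_pos by (intro mult_neg_neg) auto
  then show ?thesis
    by (simp add: zero_less_mult_iff)
qed

lemma f6_coeff_0: "f6_coeff a 0 = eta_const a"
  using a by (simp add: f6_coeff_def quot_coeff_0 alpha_const_def eta_const_def field_simps)

text \<open>Comparison with the coefficients of \<open>- ln (1 - x) / x\<close>, whose successive
  ratios are \<open>(n + 1) / (n + 2)\<close>; it bounds the growth of \<open>P\<close> at
  \<open>1\<close>.\<close>

lemma p_coeff_le: "hyp_coeff a (3 / 2 - a) (3 / 2) n \<le> 1 / (real n + 1)"
proof (induction n)
  case (Suc n)
  \<comment> \<open>Completing the square: the product is largest at \<open>a = 3/4\<close>, and the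
    resulting bound is uniform in \<open>a\<close>.\<close>
  have "a * (3 / 2 - a) = 9 / 16 - (a - 3 / 4)\<^sup>2"
    by (simp add: power2_eq_square algebra_simps)
  then have e: "a * (3 / 2 - a) \<le> 9 / 16"
    by simp
  have e': "a * (3 / 2 - a) * real n \<le> 9 / 16 * real n"
    using e by (intro mult_right_mono) auto
  have "(a + real n) * (3 / 2 - a + real n) * (real n + 2) \<le> (3 / 2 + real n) * (1 + real n) * (real n + 1)"
  proof -
    have "(3 / 2 + real n) * (1 + real n) * (real n + 1) - (a + real n) * (3 / 2 - a + real n) * (real n + 2) =
        (3 / 2 - 2 * (a * (3 / 2 - a))) + (real n - a * (3 / 2 - a) * real n)"
      by (simp add: field_simps)
    then show ?thesis
      using e e' by linarith
  qed
  then have r: "(a + real n) * (3 / 2 - a + real n) / ((3 / 2 + real n) * (1 + real n)) \<le>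
      (real n + 1) / (real n + 2)"
    by (simp add: divide_simps mult_ac)
  have "hyp_coeff a (3 / 2 - a) (3 / 2) (Suc n) \<le> 1 / (real n + 1) * ((real n + 1) / (real n + 2))"
    unfolding hyp_coeff_Suc using Suc r a by (intro mult_mono) auto
  also have "\<dots> = 1 / (real (Suc n) + 1)"
    by (simp add: divide_simps)
  finally show ?case .
qed simp

text \<open>With \<open>quot_coeff_bound\<close> this supplies the quadratic decay that
  \<open>powser_defect_at_1\<close> requires of the quotient.\<close>

lemma q_coeff_le: "hyp_coeff a (3 / 2 - a) (5 / 2) n \<le> (3 / 2) / (real n + 1)\<^sup>2"
proof -
  have "hyp_coeff a (3 / 2 - a) (5 / 2) n = hyp_coeff a (3 / 2 - a) (3 / 2) n * ((3 / 2) / (3 / 2 + real n))"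
    using hyp_coeff_add_1[of "3 / 2"] by simp
  also have "\<dots> \<le> 1 / (real n + 1) * ((3 / 2) / (real n + 1))"
    by (intro mult_mono p_coeff_le divide_left_mono) auto
  finally show ?thesis
    by (simp only: power2_eq_square times_divide_times_eq mult_1)
qed

end

section \<open>The function \<open>f6\<close>\<close>

lemma summable_norm_powser:
  fixes c :: "nat \<Rightarrow> real"
  assumes "summable (\<lambda>n. norm (c n))" "\<bar>x\<bar> \<le> 1"
  shows "summable (\<lambda>n. norm (c n * x ^ n))"
proof (rule summable_comparison_test'[OF assms(1), of 0])
  fix n
  have "\<bar>c n\<bar> * \<bar>x\<bar> ^ n \<le> \<bar>c n\<bar> * 1"
    using assms(2) by (intro mult_left_mono) (auto simp: power_le_one)
  then show "norm (norm (c n * x ^ n)) \<le> norm (c n)"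
    by (simp add: abs_mult power_abs)
qed

context
  fixes a :: real
  assumes a: "0 < a" "a < 1"
begin

lemma summable_u: "\<bar>x\<bar> < 1 \<Longrightarrow> summable (\<lambda>n. norm (hyp_coeff a (1 - a) 1 n * x ^ n))"
  using a mult_le_one[of a "1 - a"] by (intro summable_hyp) auto

lemma summable_p: "\<bar>x\<bar> < 1 \<Longrightarrow> summable (\<lambda>n. norm (hyp_coeff a (3 / 2 - a) (3 / 2) n * x ^ n))"
  using a mult_mono[of a 1 "3 / 2 - a" "3 / 2"] by (intro summable_hyp) auto

lemma summable_g: "summable (\<lambda>n. norm (hyp_coeff a (1 - a) 2 n))"
  using Gauss_hyp_sums[of a "1 - a"] a hyp_coeff_pos[of a "1 - a" 2]
  by (simp add: sums_iff abs_of_pos)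

lemma summable_q: "summable (\<lambda>n. norm (hyp_coeff a (3 / 2 - a) (5 / 2) n))"
  using Gauss_hyp_sums[of a "3 / 2 - a"] a hyp_coeff_pos[of a "3 / 2 - a" "5 / 2"]
  by (simp add: sums_iff abs_of_pos)

lemma summable_quot: "summable (\<lambda>n. norm (quot_coeff a n))"
  by (rule summable_comparison_test'[OF summable_q, of 0])
    (use quot_coeff_bound[OF a] in \<open>auto intro: order_trans[OF _ abs_ge_self]\<close>)

lemma quot_mult_q:
  assumes "\<bar>x\<bar> \<le> 1"
  shows "(\<Sum>n. quot_coeff a n * x ^ n) * hyp2F1 a (3 / 2 - a) (5 / 2) x = hyp2F1 a (1 - a) 2 x"
  using powser_mult[OF summable_norm_powser[OF summable_quot assms] summable_norm_powser[OF summable_q assms]]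
  by (simp add: hyp2F1_eq quot_coeff_conv sums_iff)

text \<open>Keeps the denominator away from \<open>0\<close> up to and including
  \<open>x = 1\<close>, where \<open>h(1)\<close> is evaluated.\<close>

lemma q_ge_1:
  assumes "0 \<le> x" "x \<le> 1"
  shows "1 \<le> hyp2F1 a (3 / 2 - a) (5 / 2) x"
proof -
  have "(\<Sum>n<1. hyp_coeff a (3 / 2 - a) (5 / 2) n * x ^ n) \<le> (\<Sum>n. hyp_coeff a (3 / 2 - a) (5 / 2) n * x ^ n)"
    using summable_norm_cancel[OF summable_norm_powser[OF summable_q, of x]] assms a
    by (intro sum_le_suminf) (auto intro!: mult_nonneg_nonneg less_imp_le[OF hyp_coeff_pos])
  then show ?thesis
    by (simp add: hyp2F1_eq)
qed

lemma quot_eq: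
  assumes "0 \<le> x" "x \<le> 1"
  shows "hyp2F1 a (1 - a) 2 x / hyp2F1 a (3 / 2 - a) (5 / 2) x = (\<Sum>n. quot_coeff a n * x ^ n)"
  using quot_mult_q[of x] q_ge_1[OF assms] assms by (simp add: divide_eq_eq)

lemma f6_coeff_sums:
  assumes "\<bar>x\<bar> < 1"
  shows "(\<lambda>n. f6_coeff a n * x ^ n) sums
    (hyp2F1 a (1 - a) 1 x - 1 / alpha_const a * ((\<Sum>n. quot_coeff a n * x ^ n) * hyp2F1 a (3 / 2 - a) (3 / 2) x))"
proof -
  have "(\<lambda>n. hyp_coeff a (1 - a) 1 n * x ^ n) sums hyp2F1 a (1 - a) 1 x"
    using summable_norm_cancel[OF summable_u[OF assms]] by (simp add: hyp2F1_eq summable_sums)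
  moreover have "(\<lambda>n. (\<Sum>k\<le>n. quot_coeff a k * hyp_coeff a (3 / 2 - a) (3 / 2) (n - k)) * x ^ n) sums
      ((\<Sum>n. quot_coeff a n * x ^ n) * hyp2F1 a (3 / 2 - a) (3 / 2) x)"
    unfolding hyp2F1_eq using assms
    by (intro powser_mult summable_norm_powser[OF summable_quot] summable_p) auto
  ultimately have "(\<lambda>n. hyp_coeff a (1 - a) 1 n * x ^ n -
        1 / alpha_const a * ((\<Sum>k\<le>n. quot_coeff a k * hyp_coeff a (3 / 2 - a) (3 / 2) (n - k)) * x ^ n)) sums
      (hyp2F1 a (1 - a) 1 x - 1 / alpha_const a * ((\<Sum>n. quot_coeff a n * x ^ n) * hyp2F1 a (3 / 2 - a) (3 / 2) x))"
    by (intro sums_diff sums_mult)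
  then show ?thesis
    unfolding f6_coeff_def by (simp only: left_diff_distrib mult.assoc)
qed

text \<open>A contiguous relation, compared coefficient by coefficient; it turns the numerator in
  \<open>f6\<close> into a multiple of \<open>x * G\<close>.\<close>

lemma elliptic_difference:
  assumes "0 \<le> x" "x < 1"
  shows "gen_ellipticE a (sqrt x) - (1 - x) * gen_ellipticK a (sqrt x) =
    pi / 2 * (a * x * hyp2F1 a (1 - a) 2 x)"
proof -
  define u where "u = hyp_coeff a (1 - a) 1"
  define g where "g = hyp_coeff a (1 - a) 2"
  define e where "e = hyp_coeff (a - 1) (1 - a) 1"
  have coeff: "e (Suc n) = u (Suc n) - u n + a * g n" for n
  proof -
    have "e (Suc n) = (a - 1) * pochhammer a n * pochhammer (1 - a) (Suc n) / (fact (Suc n))\<^sup>2"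
      by (simp add: e_def hyp_coeff_def pochhammer_rec[of "a - 1"] power2_eq_square flip: pochhammer_fact)
    also have "\<dots> = u n * ((a - 1) * (1 - a + real n) / (1 + real n)\<^sup>2)"
      by (simp add: u_def hyp_coeff_def pochhammer_Suc power2_eq_square mult_ac flip: pochhammer_fact)
    finally have 1: "e (Suc n) = u n * ((a - 1) * (1 - a + real n) / (1 + real n)\<^sup>2)" .
    have 2: "u (Suc n) = u n * ((a + real n) * (1 - a + real n) / (1 + real n)\<^sup>2)"
      unfolding u_def hyp_coeff_Suc by (simp add: power2_eq_square)
    have 3: "g n = u n * (1 / (1 + real n))"
      using hyp_coeff_add_1[of 1 a "1 - a" n] by (simp add: u_def g_def)
    \<comment> \<open>After clearing denominators this rests on
      \<open>(a + k) - (a - 1) = 1 + k\<close>.\<close>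
    have "(a - 1) * (1 - a + k) / (1 + k)\<^sup>2 = (a + k) * (1 - a + k) / (1 + k)\<^sup>2 - 1 + a * (1 / (1 + k))"
      if "1 + k \<noteq> 0" for k
      using that by (simp add: divide_simps) (simp add: power2_eq_square algebra_simps)
    from this[of "real n"]
    have 4: "(a - 1) * (1 - a + real n) / (1 + real n)\<^sup>2 =
        (a + real n) * (1 - a + real n) / (1 + real n)\<^sup>2 - 1 + a * (1 / (1 + real n))"
      by simp
    show ?thesis
      unfolding 1 2 3 4 by (simp only: right_diff_distrib distrib_left mult_1_right mult.left_commute)
  qed
  have u: "(\<lambda>n. u n * x ^ n) sums hyp2F1 a (1 - a) 1 x"
    using summable_norm_cancel[OF summable_u[of x]] assms by (simp add: hyp2F1_eq summable_sums u_def)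
  have g: "(\<lambda>n. g n * x ^ n) sums hyp2F1 a (1 - a) 2 x"
    using summable_norm_cancel[OF summable_norm_powser[OF summable_g, of x]] assms
    by (simp add: hyp2F1_eq summable_sums g_def)
  have u': "(\<lambda>n. u (Suc n) * x ^ Suc n) sums (hyp2F1 a (1 - a) 1 x - 1)"
    using u by (subst sums_Suc_iff) (simp add: u_def)
  have "(\<lambda>n. u (Suc n) * x ^ Suc n - x * (u n * x ^ n) + a * x * (g n * x ^ n)) sums
      (hyp2F1 a (1 - a) 1 x - 1 - x * hyp2F1 a (1 - a) 1 x + a * x * hyp2F1 a (1 - a) 2 x)"
    by (intro sums_add sums_diff sums_mult u u' g)
  then have "(\<lambda>n. e (Suc n) * x ^ Suc n) sums
      (hyp2F1 a (1 - a) 1 x - 1 - x * hyp2F1 a (1 - a) 1 x + a * x * hyp2F1 a (1 - a) 2 x)"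
    by (simp add: coeff algebra_simps)
  then have "(\<lambda>n. e n * x ^ n) sums
      (hyp2F1 a (1 - a) 1 x - x * hyp2F1 a (1 - a) 1 x + a * x * hyp2F1 a (1 - a) 2 x)"
    by (subst (asm) sums_Suc_iff) (simp add: e_def algebra_simps)
  then have "hyp2F1 (a - 1) (1 - a) 1 x =
      hyp2F1 a (1 - a) 1 x - x * hyp2F1 a (1 - a) 1 x + a * x * hyp2F1 a (1 - a) 2 x"
    by (simp add: hyp2F1_eq e_def sums_iff)
  then show ?thesis
    using assms by (simp add: gen_ellipticE_def gen_ellipticK_def) (simp add: field_simps)
qed

lemma f6_eq:
  assumes "x \<in> {0<..<1}"
  shows "f6 a x = pi / 2 * (hyp2F1 a (1 - a) 1 x -
    1 / alpha_const a * ((\<Sum>n. quot_coeff a n * x ^ n) * hyp2F1 a (3 / 2 - a) (3 / 2) x))"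
proof -
  have "pi / 2 * (a * x * G) / (a * A * x * Q) * P = pi / 2 * (1 / A * (G / Q * P))" for A G Q P :: real
    using assms a by (simp add: divide_simps)
  moreover have "0 \<le> x" "x < 1" "x \<le> 1"
    using assms by auto
  ultimately show ?thesis
    unfolding f6_def elliptic_difference[OF \<open>0 \<le> x\<close> \<open>x < 1\<close>]
    by (simp only: quot_eq[symmetric] gen_ellipticK_def right_diff_distrib real_sqrt_pow2)
qed

lemma f6_powser:
  assumes "x \<in> {0<..<1}"
  shows "f6 a x = (\<Sum>n. pi / 2 * f6_coeff a n * x ^ n)"
proof -
  have "\<bar>x\<bar> < 1"
    using assms by simp
  from sums_mult[OF f6_coeff_sums[OF this], of "pi / 2"] show ?thesis
    unfolding f6_eq[OF assms] by (simp add: sums_iff mult.assoc)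
qed

lemma summable_f6:
  assumes "\<bar>x\<bar> < 1"
  shows "summable (\<lambda>n. pi / 2 * f6_coeff a n * x ^ n)"
  using summable_mult[OF sums_summable[OF f6_coeff_sums[OF assms]], of "pi / 2"]
  by (simp add: mult.assoc)

lemma absolutely_monotone_f6: "absolutely_monotone_on (f6 a) {0<..<1}"
proof (rule absolutely_monotone_on_powser[OF _ summable_f6 f6_powser])
  show "0 \<le> pi / 2 * f6_coeff a n" for n
    using f6_coeff_Suc_pos[OF a, of "n - 1"] f6_coeff_0[OF a] a
    by (cases n) (auto simp: eta_const_def)
qed auto

section \<open>Limit of \<open>f6\<close> at \<open>1\<close> and its range\<close>

lemma Beta_pos: "0 < x \<Longrightarrow> 0 < y \<Longrightarrow> 0 < Beta x (y::real)"
  by (simp add: Beta_def Gamma_real_pos)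

text \<open>The quotient identity extends to \<open>x = 1\<close>, where Gauss's theorem evaluates
  both series. Divided by \<open>alpha_const a\<close> this is \<open>h(1)\<close>.\<close>

lemma suminf_quot:
  "(\<Sum>n. quot_coeff a n) = alpha_const a * (Beta a (3 / 2 - a) / Beta a (1 - a))"
proof -
  have B: "Beta (a + 1) b = a / (a + b) * Beta a b" if "0 < b" for b
  proof -
    have "a \<notin> \<int>\<^sub>\<le>\<^sub>0"
      using a by (auto elim!: nonpos_Ints_cases)
    from Beta_plus1_left[OF this, of b] show ?thesis
      using a that by (simp add: field_simps)
  qed
  have g: "hyp2F1 a (1 - a) 2 1 = 1 / ((1 - a) * (a * Beta a (1 - a)))"
    using Gauss_hyp_sums[of a "1 - a"] a B[of "1 - a"] by (simp add: hyp2F1_eq sums_iff)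
  have q: "hyp2F1 a (3 / 2 - a) (5 / 2) 1 = 1 / ((3 / 2 - a) * (a / (3 / 2) * Beta a (3 / 2 - a)))"
    using Gauss_hyp_sums[of a "3 / 2 - a"] a B[of "3 / 2 - a"] by (simp add: hyp2F1_eq sums_iff)
  have "(\<Sum>n. quot_coeff a n) = hyp2F1 a (1 - a) 2 1 / hyp2F1 a (3 / 2 - a) (5 / 2) 1"
    using quot_eq[of 1] by simp
  also have "\<dots> = alpha_const a * (Beta a (3 / 2 - a) / Beta a (1 - a))"
    unfolding g q alpha_const_def using a Beta_pos[of a "1 - a"] Beta_pos[of a "3 / 2 - a"]
    by (simp add: field_simps)
  finally show ?thesis .
qed

text \<open>By \<open>Beta_add_nat\<close> both coefficients are
  \<open>pochhammer a n / fact n\<close> times a Beta value over \<open>Beta a (1 - a)\<close>, so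
  the series is that of \<open>Digamma_diff_sums\<close> with \<open>y = 1 - a\<close> and
  \<open>d = 1/2\<close>. Nonnegativity makes the convergence absolute.\<close>

lemma balanced_difference_sums:
  "(\<lambda>n. hyp_coeff a (1 - a) 1 n - Beta a (3 / 2 - a) / Beta a (1 - a) * hyp_coeff a (3 / 2 - a) (3 / 2) n)
    sums beta_const a" (is ?sums)
  "0 \<le> hyp_coeff a (1 - a) 1 n - Beta a (3 / 2 - a) / Beta a (1 - a) * hyp_coeff a (3 / 2 - a) (3 / 2) n"
    (is ?nonneg)
proof -
  have eq: "pochhammer a n / fact n * (Beta a (1 - a + real n) - Beta a (1 - a + 1 / 2 + real n)) / Beta a (1 - a) =
    hyp_coeff a (1 - a) 1 n - Beta a (3 / 2 - a) / Beta a (1 - a) * hyp_coeff a (3 / 2 - a) (3 / 2) n" for n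
  proof -
    have 1: "Beta a (1 - a + real n) = Beta a (1 - a) * pochhammer (1 - a) n / fact n"
      using a by (subst Beta_add_nat) (auto simp: pochhammer_fact)
    have 2: "Beta a (1 - a + 1 / 2 + real n) =
        Beta a (3 / 2 - a) * pochhammer (3 / 2 - a) n / pochhammer (3 / 2) n"
      using a Beta_add_nat[of a "3 / 2 - a" n] by (simp add: algebra_simps)
    show ?thesis
      unfolding 1 2 using Beta_pos[of a "1 - a"] a
      by (simp add: hyp_coeff_def diff_divide_distrib right_diff_distrib mult_ac flip: pochhammer_fact)
  qed
  have "(\<lambda>n. pochhammer a n / fact n * (Beta a (1 - a + real n) - Beta a (1 - a + 1 / 2 + real n)) / Beta a (1 - a))
      sums ((Digamma (1 - a + 1 / 2) - Digamma (1 - a)) / Beta a (1 - a))"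
    using a by (intro sums_divide Digamma_diff_sums) auto
  moreover have "1 - a + 1 / 2 = 3 / 2 - a"
    by simp
  ultimately show ?sums
    unfolding eq beta_const_def by simp
  show ?nonneg
    unfolding eq[symmetric] using a Beta_pos[of a "1 - a"]
    by (intro divide_nonneg_nonneg mult_nonneg_nonneg pochhammer_nonneg)
      (auto intro!: Beta_real_mono)
qed

lemma hyp_p_bound:
  assumes x: "x \<in> {0<..<1}"
  shows "0 \<le> hyp2F1 a (3 / 2 - a) (3 / 2) x" "hyp2F1 a (3 / 2 - a) (3 / 2) x \<le> - ln (1 - x) / x"
proof -
  have x': "\<bar>- x\<bar> < 1" "\<bar>x\<bar> < 1"
    using x by auto
  have "(\<lambda>n. x ^ n / real n) sums (- ln (1 - x))"
    using sums_minus[OF ln_series'[OF x'(1)]] by simp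
  then have "(\<lambda>n. x ^ Suc n / real (Suc n)) sums (- ln (1 - x))"
    by (subst sums_Suc_iff) simp
  from sums_divide[OF this, of x] have l: "(\<lambda>n. 1 / (real n + 1) * x ^ n) sums (- ln (1 - x) / x)"
    using x by (simp add: mult_ac add.commute)
  show "0 \<le> hyp2F1 a (3 / 2 - a) (3 / 2) x"
    unfolding hyp2F1_eq using summable_norm_cancel[OF summable_p[OF x'(2)]] x a
    by (intro suminf_nonneg) (auto intro!: mult_nonneg_nonneg less_imp_le[OF hyp_coeff_pos])
  have "hyp2F1 a (3 / 2 - a) (3 / 2) x \<le> (\<Sum>n. 1 / (real n + 1) * x ^ n)"
    unfolding hyp2F1_eq using summable_norm_cancel[OF summable_p[OF x'(2)]] sums_summable[OF l] x
      p_coeff_le[OF a]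
    by (intro suminf_le mult_right_mono) auto
  with l show "hyp2F1 a (3 / 2 - a) (3 / 2) x \<le> - ln (1 - x) / x"
    by (simp add: sums_iff)
qed

lemma f6_tendsto: "(f6 a \<longlongrightarrow> pi * beta_const a / 2) (at_left 1)"
proof -
  define lam where "lam = Beta a (3 / 2 - a) / Beta a (1 - a)"
  define w where "w n = hyp_coeff a (1 - a) 1 n - lam * hyp_coeff a (3 / 2 - a) (3 / 2) n" for n
  define P where "P = hyp2F1 a (3 / 2 - a) (3 / 2)"
  \<comment> \<open>\<open>R\<close> is \<open>(h - h(1)) P\<close>, the part that must vanish at
    \<open>1\<close>; the series with coefficients \<open>w\<close> carries the limit.\<close>
  define R where "R x = 1 / alpha_const a * (((\<Sum>n. quot_coeff a n * x ^ n) - (\<Sum>n. quot_coeff a n)) * P x)" for x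
  have ev: "eventually (\<lambda>x::real. x \<in> {0<..<1}) (at_left 1)"
    by (rule eventually_at_left_real) simp
  have "summable (\<lambda>n. norm (w n))"
    using balanced_difference_sums by (simp add: w_def lam_def sums_iff)
  from tendsto_powser_at_left_1[OF this]
  have W: "((\<lambda>x. \<Sum>n. w n * x ^ n) \<longlongrightarrow> beta_const a) (at_left 1)"
    using balanced_difference_sums(1) by (simp add: w_def lam_def sums_iff)
  have "\<bar>quot_coeff a n\<bar> \<le> (3 / 2) / (real n + 1)\<^sup>2" for n
    using quot_coeff_bound[OF a] q_coeff_le[OF a] by (rule order_trans)
  from powser_defect_at_1[OF this] obtain D where D: "0 \<le> D"
    "\<And>x. x \<in> {0<..<1} \<Longrightarrow> \<bar>(\<Sum>n. quot_coeff a n) - (\<Sum>n. quot_coeff a n * x ^ n)\<bar> \<le> D * sqrt (1 - x)"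
    by blast
  \<comment> \<open>The square-root decay of the defect beats the logarithmic growth of
    \<open>P\<close>.\<close>
  have "((\<lambda>x. 1 / alpha_const a * (D * sqrt (1 - x) * (- ln (1 - x) / x))) \<longlongrightarrow> 0) (at_left 1)"
    by real_asymp
  moreover have "eventually (\<lambda>x. norm (R x) \<le> 1 / alpha_const a * (D * sqrt (1 - x) * (- ln (1 - x) / x))) (at_left 1)"
    using ev
  proof eventually_elim
    case (elim x)
    have "norm (R x) = 1 / alpha_const a * (\<bar>(\<Sum>n. quot_coeff a n) - (\<Sum>n. quot_coeff a n * x ^ n)\<bar> * P x)"
      using hyp_p_bound(1)[OF elim] alpha_pos[OF a] by (simp add: R_def abs_mult P_def abs_minus_commute)
    also have "\<dots> \<le> 1 / alpha_const a * (D * sqrt (1 - x) * (- ln (1 - x) / x))"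
      using hyp_p_bound[OF elim] alpha_pos[OF a] D(2)[OF elim] D(1) elim
      by (intro mult_left_mono mult_mono) (auto simp: P_def)
    finally show ?case .
  qed
  ultimately have "(R \<longlongrightarrow> 0) (at_left 1)"
    by (rule Lim_null_comparison[rotated])
  then have "((\<lambda>x. pi / 2 * ((\<Sum>n. w n * x ^ n) - R x)) \<longlongrightarrow> pi / 2 * (beta_const a - 0)) (at_left 1)"
    by (intro tendsto_intros W)
  moreover have "eventually (\<lambda>x. pi / 2 * ((\<Sum>n. w n * x ^ n) - R x) = f6 a x) (at_left 1)"
    using ev
  proof eventually_elim
    case (elim x)
    then have x: "\<bar>x\<bar> < 1"
      by simp
    have "(\<lambda>n. hyp_coeff a (1 - a) 1 n * x ^ n - lam * (hyp_coeff a (3 / 2 - a) (3 / 2) n * x ^ n)) sums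
        (hyp2F1 a (1 - a) 1 x - lam * P x)"
      unfolding P_def hyp2F1_eq
      by (intro sums_diff sums_mult summable_sums summable_norm_cancel[OF summable_u[OF x]]
        summable_norm_cancel[OF summable_p[OF x]])
    then have "(\<Sum>n. w n * x ^ n) = hyp2F1 a (1 - a) 1 x - lam * P x"
      by (simp add: w_def sums_iff left_diff_distrib mult.assoc)
    moreover have "1 / alpha_const a * (\<Sum>n. quot_coeff a n) = lam"
      using suminf_quot alpha_pos[OF a] by (simp add: lam_def)
    then have "R x = 1 / alpha_const a * ((\<Sum>n. quot_coeff a n * x ^ n) * P x) - lam * P x"
      unfolding R_def by (simp only: left_diff_distrib right_diff_distrib mult.assoc[symmetric])
    ultimately show ?case
      unfolding f6_eq[OF elim] P_def by simp
  qed
  ultimately have "(f6 a \<longlongrightarrow> pi / 2 * (beta_const a - 0)) (at_left 1)"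
    by (rule Lim_transform_eventually)
  then show ?thesis
    by simp
qed

lemma f6_powser_tendsto:
  "((\<lambda>x. \<Sum>n. pi / 2 * f6_coeff a n * x ^ n) \<longlongrightarrow> pi * beta_const a / 2) (at_left 1)"
proof -
  have "eventually (\<lambda>x. f6 a x = (\<Sum>n. pi / 2 * f6_coeff a n * x ^ n)) (at_left 1)"
    using eventually_at_left_real[OF zero_less_one] by eventually_elim (rule f6_powser)
  from Lim_transform_eventually[OF f6_tendsto this] show ?thesis .
qed

lemma f6_image: "f6 a ` {0<..<1} = {pi * eta_const a / 2<..<pi * beta_const a / 2}"
proof -
  have "f6 a ` {0<..<1} = (\<lambda>x. \<Sum>n. pi / 2 * f6_coeff a n * x ^ n) ` {0<..<1}"
    by (rule image_cong) (auto simp: f6_powser)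
  also have "\<dots> = {pi / 2 * f6_coeff a 0<..<pi * beta_const a / 2}"
    by (intro powser_image summable_f6 f6_powser_tendsto) (simp_all add: f6_coeff_Suc_pos[OF a])
  finally show ?thesis
    by (simp add: f6_coeff_0[OF a])
qed

lemma f6_less_chord:
  assumes "x \<in> {0<..<1}"
  shows "f6 a x < pi * eta_const a / 2 + (pi * beta_const a / 2 - pi * eta_const a / 2) * x"
proof -
  have "(\<Sum>n. pi / 2 * f6_coeff a n * x ^ n) <
      pi / 2 * f6_coeff a 0 + (pi * beta_const a / 2 - pi / 2 * f6_coeff a 0) * x"
    using assms
    by (intro powser_less_chord summable_f6 f6_powser_tendsto) (simp_all add: f6_coeff_Suc_pos[OF a])
  then show ?thesis
    unfolding f6_powser[OF assms] by (simp add: f6_coeff_0[OF a])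
qed

end

section \<open>The case \<open>a = 1/2\<close>\<close>

text \<open>At \<open>a = 1/2\<close> the parameter \<open>3/2 - a\<close> is \<open>1\<close>, and
  \<open>P\<close> becomes the series of \<open>artanh (sqrt x) / sqrt x\<close>.\<close>

lemma hyp_coeff_half [simp]: "hyp_coeff (1 / 2) 1 (3 / 2) n = 1 / (2 * real n + 1)"
proof (induction n)
  case (Suc n)
  have "1 / (2 * k + 1) * ((1 / 2 + k) * (1 + k) / ((3 / 2 + k) * (1 + k))) = 1 / (2 * (1 + k) + 1)"
    if "k \<ge> 0" for k :: real
    using that by (simp add: divide_simps) (simp add: algebra_simps)
  from this[of "real n"] show ?case
    unfolding hyp_coeff_Suc Suc by simp
qed simp

lemma artanh_sums:
  assumes "r \<in> {0<..<1}"
  shows "(\<lambda>n. 1 / (2 * real n + 1) * (r\<^sup>2) ^ n) sums (artanh r / r)"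
proof -
  \<comment> \<open>The series \<open>ln_series_quadratic\<close> for \<open>ln t\<close> runs in
    powers of \<open>(t - 1) / (t + 1)\<close>, which is \<open>r\<close> for this
    \<open>t\<close>.\<close>
  have "((1 + r) / (1 - r) - 1) / ((1 + r) / (1 - r) + 1) = r" "(1 + r) / (1 - r) > 0"
    using assms by (auto simp: field_simps)
  with ln_series_quadratic[of "(1 + r) / (1 - r)"]
  have "(\<lambda>n. 2 * r ^ (2 * n + 1) / real (2 * n + 1)) sums ln ((1 + r) / (1 - r))"
    by simp
  from sums_divide[OF this, of "2 * r"] show ?thesis
    using assms by (simp add: artanh_def power_mult add.commute)
qed

lemma artanh_eq_hyp2F1:
  "r \<in> {0<..<1} \<Longrightarrow> artanh r / r = hyp2F1 (1 / 2) 1 (3 / 2) (r\<^sup>2)"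
  using artanh_sums[of r] by (simp add: hyp2F1_eq sums_iff)

lemma sqrt_unit: "x \<in> {0<..<1} \<Longrightarrow> sqrt x \<in> {0<..<1}" for x :: real
  by simp

lemma square_unit: "r \<in> {0<..<1} \<Longrightarrow> r\<^sup>2 \<in> {0<..<1}" for r :: real
  by (simp add: power_less_one_iff)

text \<open>The differences \<open>1 / (2n + 1) - 1 / (2n + 3)\<close> are \<open>2/3\<close> times
  the coefficients of \<open>Q\<close>. Since \<open>2/3\<close> is \<open>a * alpha_const a\<close>
  at \<open>a = 1/2\<close>, this is the denominator in \<open>f6\<close>.\<close>

lemma h13_denominator:
  assumes x: "x \<in> {0<..<1}"
  shows "1 - (1 - x) * (artanh (sqrt x) / sqrt x) = 2 / 3 * x * hyp2F1 (1 / 2) 1 (5 / 2) x"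
proof -
  define A where "A = artanh (sqrt x) / sqrt x"
  have A: "(\<lambda>n. 1 / (2 * real n + 1) * x ^ n) sums A"
    using artanh_sums[OF sqrt_unit[OF x]] x by (simp add: A_def)
  have A': "(\<lambda>n. 1 / (2 * real (Suc n) + 1) * x ^ Suc n) sums (A - 1)"
    using A by (subst sums_Suc_iff) simp
  have "(\<lambda>n. x * (1 / (2 * real n + 1) * x ^ n) - 1 / (2 * real (Suc n) + 1) * x ^ Suc n) sums (x * A - (A - 1))"
    by (intro sums_diff sums_mult A A')
  moreover have "x * (1 / (2 * real n + 1) * x ^ n) - 1 / (2 * real (Suc n) + 1) * x ^ Suc n =
      2 / 3 * x * (hyp_coeff (1 / 2) 1 (5 / 2) n * x ^ n)" for n
  proof -
    have "hyp_coeff (1 / 2) 1 (5 / 2) n = 1 / (2 * real n + 1) * (3 / (2 * real n + 3))"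
      using hyp_coeff_add_1[of "3 / 2" "1 / 2" 1 n] by (simp add: field_simps)
    moreover have "1 / (2 * k + 1) - 1 / (2 * (1 + k) + 1) = 2 / 3 * (1 / (2 * k + 1) * (3 / (2 * k + 3)))"
      if "k \<ge> 0" for k :: real
      using that by (simp add: divide_simps)
    from this[of "real n"]
    have "1 / (2 * real n + 1) - 1 / (2 * real (Suc n) + 1) = 2 / 3 * (1 / (2 * real n + 1) * (3 / (2 * real n + 3)))"
      by simp
    ultimately have "2 / 3 * x * (hyp_coeff (1 / 2) 1 (5 / 2) n * x ^ n) =
        x * x ^ n * (1 / (2 * real n + 1) - 1 / (2 * real (Suc n) + 1))"
      by (simp only: mult_ac)
    then show ?thesis
      by (simp only: right_diff_distrib power_Suc mult_ac)
  qed
  ultimately have 1: "(\<lambda>n. 2 / 3 * x * (hyp_coeff (1 / 2) 1 (5 / 2) n * x ^ n)) sums (x * A - (A - 1))"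
    by (simp only:)
  have "(\<lambda>n. 2 / 3 * x * (hyp_coeff (1 / 2) 1 (5 / 2) n * x ^ n)) sums (2 / 3 * x * hyp2F1 (1 / 2) 1 (5 / 2) x)"
    using summable_norm_cancel[OF summable_norm_powser[OF summable_q[of "1 / 2"], of x]] x
    unfolding hyp2F1_eq by (intro sums_mult summable_sums) simp
  from sums_unique2[OF 1 this] show ?thesis
    unfolding A_def[symmetric] by (simp add: algebra_simps)
qed

abbreviation quot_half :: "real \<Rightarrow> real" where
  "quot_half x \<equiv> \<Sum>n. quot_coeff (1 / 2) n * x ^ n"

lemma h13_eq:
  assumes x: "x \<in> {0<..<1}"
  shows "h13 x = 3 * pi / 8 * quot_half x"
proof -
  define G where "G = hyp2F1 (1 / 2) (1 / 2) 2 x"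
  define Q where "Q = hyp2F1 (1 / 2) 1 (5 / 2) x"
  have 1: "ellipticE (sqrt x) - (1 - x) * ellipticK (sqrt x) = pi / 2 * (1 / 2 * x * G)"
    using elliptic_difference[of "1 / 2" x] x by (simp add: G_def)
  have 2: "quot_half x = G / Q"
    using quot_eq[of "1 / 2" x] x by (simp add: G_def Q_def)
  show ?thesis
    unfolding h13_def h13_denominator[OF x] 1 2 using x by (simp add: Q_def divide_simps)
qed

lemma alpha_half: "alpha_const (1 / 2) = 4 / 3"
  by (simp add: alpha_const_def)

lemma f7_eq_f6:
  assumes x: "x \<in> {0<..<1}"
  shows "f7 x = f6 (1 / 2) x"
proof -
  have A: "artanh (sqrt x) / sqrt x = hyp2F1 (1 / 2) 1 (3 / 2) x"
    using artanh_eq_hyp2F1[OF sqrt_unit[OF x]] x by simp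
  have 1: "f6 (1 / 2) x = pi / 2 * (hyp2F1 (1 / 2) (1 / 2) 1 x - 3 / 4 * (quot_half x * hyp2F1 (1 / 2) 1 (3 / 2) x))"
    using f6_eq[of "1 / 2" x] x by (simp add: alpha_half)
  show ?thesis
    unfolding 1 f7_def A h13_eq[OF x] using x by (simp add: gen_ellipticK_def right_diff_distrib)
qed

lemma eta_half: "pi * eta_const (1 / 2) / 2 = pi / 8"
  by (simp add: eta_const_def)

lemma Beta_half_half: "Beta (1 / 2) (1 / 2) = pi"
  by (simp add: Beta_def Gamma_one_half_real)

text \<open>Rests on \<open>Digamma 1 - Digamma (1 / 2) = 2 * ln 2\<close>.\<close>

lemma beta_half: "pi * beta_const (1 / 2) / 2 = ln 2"
  by (simp add: beta_const_def Beta_half_half Digamma_one_half)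

lemma absolutely_monotone_f7: "absolutely_monotone_on f7 {0<..<1}"
proof (rule absolutely_monotone_on_powser)
  show "0 \<le> pi / 2 * f6_coeff (1 / 2) n" for n
    using f6_coeff_Suc_pos[of "1 / 2" "n - 1"] f6_coeff_0[of "1 / 2"]
    by (cases n) (auto simp: eta_const_def)
  show "summable (\<lambda>n. pi / 2 * f6_coeff (1 / 2) n * x ^ n)" if "\<bar>x\<bar> < 1" for x
    by (rule summable_f6) (use that in auto)
  show "f7 x = (\<Sum>n. pi / 2 * f6_coeff (1 / 2) n * x ^ n)" if "x \<in> {0<..<1}" for x
    using f6_powser[of "1 / 2" x] f7_eq_f6[OF that] that by simp
qed

lemma f7_image: "f7 ` {0<..<1} = {pi / 8<..<ln 2}"
proof -
  have "f7 ` {0<..<1} = f6 (1 / 2) ` {0<..<1}"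
    by (rule image_cong) (simp_all add: f7_eq_f6)
  then show ?thesis
    using f6_image[of "1 / 2"] by (simp add: eta_half beta_half)
qed

lemma f7_bounds:
  assumes x: "x \<in> {0<..<1}"
  shows "pi / 8 < f7 x" "f7 x < pi / 8 + (ln 2 - pi / 8) * x"
  using f7_image imageI[OF x, of f7] f6_less_chord[of "1 / 2" x] f7_eq_f6[OF x] x
  by (auto simp: eta_half beta_half)

lemma f7_tendsto_1: "(f7 \<longlongrightarrow> ln 2) (at_left 1)"
proof -
  have "eventually (\<lambda>x. f6 (1 / 2) x = f7 x) (at_left 1)"
    using eventually_at_left_real[OF zero_less_one] by eventually_elim (simp add: f7_eq_f6)
  from Lim_transform_eventually[OF f6_tendsto[of "1 / 2"] this] show ?thesis
    by (simp add: beta_half)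
qed

section \<open>Explicit coefficients and the tail of the series of \<open>h13\<close>\<close>

text \<open>The convolution identities form a triangular system with unit diagonal and are solved
  one after another.\<close>

lemma quot_half_coeffs:
  "quot_coeff (1 / 2) 0 = 1" "quot_coeff (1 / 2) 1 = - 3 / 40"
  "quot_coeff (1 / 2) 2 = - 267 / 11200" "quot_coeff (1 / 2) 3 = - 32279 / 2688000"
  "quot_coeff (1 / 2) 4 = - 40472969 / 5519360000"
proof -
  have g: "hyp_coeff (1 / 2) (1 / 2) 2 1 = 1 / 8" "hyp_coeff (1 / 2) (1 / 2) 2 2 = 3 / 64"
    "hyp_coeff (1 / 2) (1 / 2) 2 3 = 25 / 1024" "hyp_coeff (1 / 2) (1 / 2) 2 4 = 245 / 16384"
    by (simp_all add: eval_nat_numeral hyp_coeff_Suc)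
  have q: "hyp_coeff (1 / 2) 1 (5 / 2) 1 = 1 / 5" "hyp_coeff (1 / 2) 1 (5 / 2) 2 = 3 / 35"
    "hyp_coeff (1 / 2) 1 (5 / 2) 3 = 1 / 21" "hyp_coeff (1 / 2) 1 (5 / 2) 4 = 1 / 33"
    by (simp_all add: eval_nat_numeral hyp_coeff_Suc)
  have conv: "hyp_coeff (1 / 2) (1 / 2) 2 n =
      (\<Sum>k\<le>n. quot_coeff (1 / 2) k * hyp_coeff (1 / 2) 1 (5 / 2) (n - k))" for n
    using quot_coeff_conv[of "1 / 2" n] by simp
  show h0: "quot_coeff (1 / 2) 0 = 1"
    by (rule quot_coeff_0) auto
  have sum: "(\<Sum>k\<le>1. f k) = f 0 + f 1" "(\<Sum>k\<le>2. f k) = f 0 + f 1 + f 2"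
    "(\<Sum>k\<le>3. f k) = f 0 + f 1 + f 2 + f 3" "(\<Sum>k\<le>4. f k) = f 0 + f 1 + f 2 + f 3 + f 4"
    for f :: "nat \<Rightarrow> real"
    by (simp_all add: eval_nat_numeral)
  show h1: "quot_coeff (1 / 2) 1 = - 3 / 40"
    using conv[of 1] unfolding sum g by (simp add: h0 q del: One_nat_def)
  show h2: "quot_coeff (1 / 2) 2 = - 267 / 11200"
    using conv[of 2] unfolding sum g by (simp add: h0 h1 q[unfolded One_nat_def] q del: One_nat_def)
  show h3: "quot_coeff (1 / 2) 3 = - 32279 / 2688000"
    using conv[of 3] unfolding sum g by (simp add: h0 h1 h2 q[unfolded One_nat_def] q del: One_nat_def)
  show "quot_coeff (1 / 2) 4 = - 40472969 / 5519360000"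
    using conv[of 4] unfolding sum g by (simp add: h0 h1 h2 h3 q[unfolded One_nat_def] q del: One_nat_def)
qed

text \<open>The sign is chosen so that the coefficients are positive and the monotonicity and chord
  lemmas apply.\<close>

definition tail :: "real \<Rightarrow> real" where
  "tail x = (\<Sum>n. - quot_coeff (1 / 2) (n + 4) * x ^ n)"

lemma summable_tail:
  assumes "\<bar>x\<bar> \<le> 1"
  shows "summable (\<lambda>n. norm (- quot_coeff (1 / 2) (n + 4) * x ^ n))"
proof -
  have "summable (\<lambda>n. norm (quot_coeff (1 / 2) n))"
    by (rule summable_quot) auto
  then have "summable (\<lambda>n. norm (quot_coeff (1 / 2) (n + 4)))"
    by (rule summable_ignore_initial_segment)
  then show ?thesis
    using summable_norm_powser[OF _ assms, of "\<lambda>n. - quot_coeff (1 / 2) (n + 4)"] by simp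
qed

lemma quot_half_eq_tail:
  assumes "\<bar>x\<bar> \<le> 1"
  shows "quot_half x = 1 - 3 / 40 * x - 267 / 11200 * x ^ 2 - 32279 / 2688000 * x ^ 3 - tail x * x ^ 4"
proof -
  have "summable (\<lambda>n. norm (quot_coeff (1 / 2) n))"
    by (rule summable_quot) auto
  then have s: "summable (\<lambda>n. quot_coeff (1 / 2) n * x ^ n)"
    by (intro summable_norm_cancel[OF summable_norm_powser] assms)
  have "quot_half x = (\<Sum>n. quot_coeff (1 / 2) (n + 4) * x ^ (n + 4)) + (\<Sum>n<4. quot_coeff (1 / 2) n * x ^ n)"
    by (rule suminf_split_initial_segment[OF s])
  also have "(\<Sum>n. quot_coeff (1 / 2) (n + 4) * x ^ (n + 4)) = - tail x * x ^ 4"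
    unfolding tail_def using suminf_mult2[OF summable_norm_cancel[OF summable_tail[OF assms]], of "x ^ 4"]
      suminf_minus[OF summable_mult2[OF summable_norm_cancel[OF summable_tail[OF assms]], of "x ^ 4"]]
    by (simp add: power_add mult.assoc)
  also have "(\<Sum>n<4. quot_coeff (1 / 2) n * x ^ n) =
      1 - 3 / 40 * x - 267 / 11200 * x ^ 2 - 32279 / 2688000 * x ^ 3"
  proof -
    have "(\<Sum>n<4. f n) = f 0 + f 1 + f 2 + f 3" for f :: "nat \<Rightarrow> real"
      by (simp add: eval_nat_numeral)
    then show ?thesis
      by (simp add: quot_half_coeffs del: One_nat_def)
  qed
  finally show ?thesis
    by simp
qed

lemma quot_half_1: "quot_half 1 = 8 / (3 * pi)"
proof -
  have "(1 / 2 :: real) \<notin> \<int>\<^sub>\<le>\<^sub>0"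
    using nonpos_Ints_nonpos[of "1 / 2 :: real"] by auto
  then have G: "Gamma (3 / 2 :: real) = sqrt pi / 2"
    using Gamma_plus1[of "1 / 2 :: real"] by (simp add: Gamma_one_half_real)
  have "Beta (1 / 2) (1 :: real) = 2"
    by (simp add: Beta_def Gamma_one_half_real G)
  then show ?thesis
    using suminf_quot[of "1 / 2"] by (simp add: alpha_half Beta_half_half)
qed

text \<open>The expansion holds at \<open>x = 1\<close> as well; the rational number is
  \<open>1 - 3/40 - 267/11200 - 32279/2688000\<close>.\<close>

lemma tail_1: "tail 1 = 2390041 / 2688000 - 8 / (3 * pi)"
  using quot_half_eq_tail[of 1] quot_half_1 by simp

lemma tail_tendsto_1: "(tail \<longlongrightarrow> tail 1) (at_left 1)"
  using tendsto_powser_at_left_1[of "\<lambda>n. - quot_coeff (1 / 2) (n + 4)"] summable_tail[of 1]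
  by (simp add: tail_def[abs_def])

text \<open>The values of \<open>tail\<close> at \<open>0\<close> and \<open>1\<close> are the two
  extreme coefficients of \<open>r ^ 8\<close>. The chord bound serves for the limit at
  \<open>0\<close>.\<close>

lemma tail_bounds:
  assumes x: "x \<in> {0<..<1}"
  shows "40472969 / 5519360000 < tail x" "tail x < tail 1"
    "tail x < 40472969 / 5519360000 + (tail 1 - 40472969 / 5519360000) * x"
proof -
  define c where "c n = - quot_coeff (1 / 2) (n + 4)" for n
  have tail: "tail x = (\<Sum>n. c n * x ^ n)" for x
    by (simp add: tail_def c_def)
  have pos: "0 < c (Suc n)" for n
    using quot_coeff_neg[of "1 / 2" "n + 4"] by (simp add: c_def)
  have sm: "summable (\<lambda>n. c n * x ^ n)" if "\<bar>x\<bar> < 1" for x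
    using summable_norm_cancel[OF summable_tail[of x]] that by (simp add: c_def)
  have lim: "((\<lambda>x. \<Sum>n. c n * x ^ n) \<longlongrightarrow> tail 1) (at_left 1)"
    using tail_tendsto_1 by (simp only: tail[abs_def])
  have c0: "c 0 = 40472969 / 5519360000"
    by (simp add: quot_half_coeffs c_def)
  show "40472969 / 5519360000 < tail x"
    using powser_strict_mono[OF pos sm, of 0 x] x unfolding powser_zero tail[symmetric] c0 by simp
  show "tail x < tail 1"
    using powser_less_limit[OF pos sm lim, of x] x unfolding tail[symmetric] by simp
  show "tail x < 40472969 / 5519360000 + (tail 1 - 40472969 / 5519360000) * x"
    using powser_less_chord[OF pos sm lim, of x] x unfolding tail[symmetric] c0 by simp
qed

section \<open>The chain of bounds and its sharpness\<close>

lemma h13_square: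
  assumes r: "r \<in> {0<..<1}"
  shows "h13 (r\<^sup>2) = 3 * pi / 8 *
    (1 - 3 / 40 * r ^ 2 - 267 / 11200 * r ^ 4 - 32279 / 2688000 * r ^ 6 - tail (r\<^sup>2) * r ^ 8)"
  using h13_eq[OF square_unit[OF r]] quot_half_eq_tail[of "r\<^sup>2"] square_unit[OF r]
  by (simp flip: power_mult)

lemma artanh_quotient_pos:
  fixes r :: real
  assumes "r \<in> {0<..<1}"
  shows "0 < artanh r / r"
  using assms by (simp add: artanh_def)

lemma f7_square:
  assumes r: "r \<in> {0<..<1}"
  shows "f7 (r\<^sup>2) = ellipticK r - h13 (r\<^sup>2) * (artanh r / r)"
  using r by (simp add: f7_def)

definition lower_params :: "real list" where
  "lower_params = [pi / 8, 3 * pi / 8, 1, 3 / 40, 267 / 11200, 32279 / 2688000,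
    2390041 / 2688000 - 8 / (3 * pi)]"

definition upper_params :: "real list" where
  "upper_params = [pi / 8, ln 2 - pi / 8, 3 * pi / 8, 1, 3 / 40, 267 / 11200, 32279 / 2688000,
    40472969 / 5519360000]"

text \<open>Both bounds come from one expansion and differ only in taking \<open>tail\<close> at
  \<open>r\<^sup>2\<close> or at \<open>1\<close>.\<close>

lemma lower_gap:
  assumes r: "r \<in> {0<..<1}"
  shows "lower_inner [pi / 8] r - lower_outer lower_params r =
    3 * pi / 8 * (artanh r / r) * (tail 1 - tail (r\<^sup>2)) * r ^ 8"
proof -
  define A where "A = artanh r / r"
  show ?thesis
    unfolding lower_inner_def lower_outer_def lower_params_def h13_square[OF r] tail_1 A_def[symmetric]
    by (simp add: algebra_simps)
qed

lemma upper_gap: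
  assumes r: "r \<in> {0<..<1}"
  shows "upper_outer upper_params r - upper_inner [pi / 8, ln 2 - pi / 8] r =
    3 * pi / 8 * (artanh r / r) * (tail (r\<^sup>2) - 40472969 / 5519360000) * r ^ 8"
proof -
  define A where "A = artanh r / r"
  show ?thesis
    unfolding upper_inner_def upper_outer_def upper_params_def h13_square[OF r] A_def[symmetric]
    by (simp add: algebra_simps)
qed

lemma ellipticK_gaps:
  assumes r: "r \<in> {0<..<1}"
  shows "ellipticK r - lower_inner [pi / 8] r = f7 (r\<^sup>2) - pi / 8"
    "upper_inner [pi / 8, ln 2 - pi / 8] r - ellipticK r = pi / 8 + (ln 2 - pi / 8) * r\<^sup>2 - f7 (r\<^sup>2)"
  unfolding f7_square[OF r] by (simp_all add: lower_inner_def upper_inner_def)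

lemma ellipticK_chain:
  assumes r: "r \<in> {0<..<1}"
  shows "lower_outer lower_params r < lower_inner [pi / 8] r"
    "lower_inner [pi / 8] r < ellipticK r"
    "ellipticK r < upper_inner [pi / 8, ln 2 - pi / 8] r"
    "upper_inner [pi / 8, ln 2 - pi / 8] r < upper_outer upper_params r"
proof -
  note x = square_unit[OF r]
  have "0 < 3 * pi / 8 * (artanh r / r) * (tail 1 - tail (r\<^sup>2)) * r ^ 8"
    using tail_bounds[OF x] artanh_quotient_pos[OF r] r by (intro mult_pos_pos) auto
  with lower_gap[OF r] show "lower_outer lower_params r < lower_inner [pi / 8] r"
    by simp
  have "0 < 3 * pi / 8 * (artanh r / r) * (tail (r\<^sup>2) - 40472969 / 5519360000) * r ^ 8"
    using tail_bounds[OF x] artanh_quotient_pos[OF r] r by (intro mult_pos_pos) auto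
  with upper_gap[OF r] show "upper_inner [pi / 8, ln 2 - pi / 8] r < upper_outer upper_params r"
    by simp
  show "lower_inner [pi / 8] r < ellipticK r" "ellipticK r < upper_inner [pi / 8, ln 2 - pi / 8] r"
    using ellipticK_gaps[OF r] f7_bounds[OF x] by simp_all
qed

section \<open>The perturbation argument for optimality\<close>

text \<open>The change \<open>d * M\<close> of a bound must fit into \<open>gap\<close>. On the
  scale \<open>s\<close> the gap is negligible, which forces \<open>d * m \<le> 0\<close>, while an
  improvement forces \<open>0 \<le> d * m\<close>. As \<open>m \<noteq> 0\<close>, only
  \<open>d = 0\<close> remains, and then nothing is improved anywhere.\<close>

lemma perturbation_contradiction:
  fixes M s gap :: "real \<Rightarrow> real"
  assumes F: "F \<noteq> bot" and ev: "eventually (\<lambda>r. r \<in> {0<..<1} \<and> 0 < s r) F"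
    and gap: "((\<lambda>r. gap r / s r) \<longlongrightarrow> 0) F"
    and M: "((\<lambda>r. M r / s r) \<longlongrightarrow> m) F" "m \<noteq> 0"
    and nonneg: "\<And>r. r \<in> {0<..<1} \<Longrightarrow> 0 \<le> d * M r"
    and pos: "\<exists>r\<in>{0<..<1}. 0 < d * M r"
    and less: "\<And>r. r \<in> {0<..<1} \<Longrightarrow> d * M r < gap r"
  shows False
proof -
  have lim: "((\<lambda>r. d * (M r / s r)) \<longlongrightarrow> d * m) F"
    by (intro tendsto_intros M)
  have "eventually (\<lambda>r. 0 \<le> d * (M r / s r)) F"
    using ev by eventually_elim (use nonneg in \<open>force intro!: divide_nonneg_pos\<close>)
  from tendsto_lowerbound[OF lim this F] have "0 \<le> d * m" .
  moreover have "eventually (\<lambda>r. d * (M r / s r) \<le> gap r / s r) F"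
    using ev
  proof eventually_elim
    case (elim r)
    then have "d * M r / s r \<le> gap r / s r"
      using less[of r] by (intro divide_right_mono) auto
    then show ?case
      by simp
  qed
  from tendsto_le[OF F gap lim this] have "d * m \<le> 0" .
  ultimately show False
    using M(2) pos by auto
qed

text \<open>Here \<open>g\<close> stands for the next member of the chain above \<open>old\<close>,
  and \<open>M\<close> for the effect of the constant that is changed.\<close>

lemma lower_sharp:
  fixes M s :: "real \<Rightarrow> real"
  assumes F: "F \<noteq> bot" and ev: "eventually (\<lambda>r. r \<in> {0<..<1} \<and> 0 < s r) F"
    and gap: "((\<lambda>r. (g r - old r) / s r) \<longlongrightarrow> 0) F"
    and M: "((\<lambda>r. M r / s r) \<longlongrightarrow> m) F" "m \<noteq> 0"
    and eq: "\<And>r. new r - old r = d * M r"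
    and sharper: "sharper_lower new old"
    and less: "\<And>r. r \<in> {0<..<1} \<Longrightarrow> new r < g r"
  shows False
proof (rule perturbation_contradiction[OF F ev gap M])
  show "0 \<le> d * M r" "d * M r < g r - old r" if "r \<in> {0<..<1}" for r
    using sharper less[OF that] that unfolding eq[symmetric] sharper_lower_def by auto
  show "\<exists>r\<in>{0<..<1}. 0 < d * M r"
    using sharper unfolding eq[symmetric] sharper_lower_def by auto
qed

lemma upper_sharp:
  fixes M s :: "real \<Rightarrow> real"
  assumes F: "F \<noteq> bot" and ev: "eventually (\<lambda>r. r \<in> {0<..<1} \<and> 0 < s r) F"
    and gap: "((\<lambda>r. (old r - g r) / s r) \<longlongrightarrow> 0) F"
    and M: "((\<lambda>r. M r / s r) \<longlongrightarrow> m) F" "m \<noteq> 0"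
    and eq: "\<And>r. old r - new r = d * M r"
    and sharper: "sharper_upper new old"
    and less: "\<And>r. r \<in> {0<..<1} \<Longrightarrow> g r < new r"
  shows False
proof (rule perturbation_contradiction[OF F ev gap M])
  show "0 \<le> d * M r" "d * M r < old r - g r" if "r \<in> {0<..<1}" for r
    using sharper less[OF that] that unfolding eq[symmetric] sharper_upper_def by auto
  show "\<exists>r\<in>{0<..<1}. 0 < d * M r"
    using sharper unfolding eq[symmetric] sharper_upper_def by auto
qed

lemma eventually_unit_at_right_0: "eventually (\<lambda>r::real. r \<in> {0<..<1}) (at_right 0)"
  by (rule eventually_at_right_real) simp

lemma eventually_unit_at_left_1: "eventually (\<lambda>r::real. r \<in> {0<..<1}) (at_left 1)"
  by (rule eventually_at_left_real) simp

lemma tendsto_mult_power_cancel: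
  assumes "(f \<longlongrightarrow> m) (at_right (0::real))"
  shows "((\<lambda>r. f r * r ^ k / r ^ k) \<longlongrightarrow> m) (at_right 0)"
  by (rule Lim_transform_eventually[OF assms], use eventually_unit_at_right_0 in eventually_elim) simp

lemma tendsto_lower_power:
  assumes "((\<lambda>r. gap r / r ^ k) \<longlongrightarrow> 0) (at_right (0::real))" "j \<le> k"
  shows "((\<lambda>r. gap r / r ^ j) \<longlongrightarrow> 0) (at_right 0)"
proof (rule Lim_transform_eventually)
  have "((\<lambda>r. gap r / r ^ k * r ^ (k - j)) \<longlongrightarrow> 0 * 0 ^ (k - j)) (at_right 0)"
    by (intro tendsto_intros assms(1))
  then show "((\<lambda>r. gap r / r ^ k * r ^ (k - j)) \<longlongrightarrow> 0) (at_right 0)"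
    by simp
  show "eventually (\<lambda>r. gap r / r ^ k * r ^ (k - j) = gap r / r ^ j) (at_right 0)"
    using eventually_unit_at_right_0
    by eventually_elim (use assms(2) in \<open>simp add: power_diff\<close>)
qed

text \<open>One estimate of the gap, at the order \<open>l\<close>, disposes of every constant whose
  effect is of exact order \<open>r ^ k\<close> with \<open>k \<le> l\<close>.\<close>

lemma lower_sharp_0:
  assumes gap: "((\<lambda>r. (g r - old r) / r ^ l) \<longlongrightarrow> 0) (at_right 0)" "k \<le> l"
    and f: "(f \<longlongrightarrow> m) (at_right 0)" "m \<noteq> 0"
    and eq: "\<And>r. new r - old r = d * (f r * r ^ k)"
    and sharper: "sharper_lower new old"
    and less: "\<And>r. r \<in> {0<..<1} \<Longrightarrow> new r < g r"
  shows False
  by (rule lower_sharp[OF _ _ tendsto_lower_power[OF gap] tendsto_mult_power_cancel[OF f(1)] f(2) eq sharper less])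
    (use eventually_unit_at_right_0 in \<open>auto elim: eventually_mono\<close>)

lemma upper_sharp_0:
  assumes gap: "((\<lambda>r. (old r - g r) / r ^ l) \<longlongrightarrow> 0) (at_right 0)" "k \<le> l"
    and f: "(f \<longlongrightarrow> m) (at_right 0)" "m \<noteq> 0"
    and eq: "\<And>r. old r - new r = d * (f r * r ^ k)"
    and sharper: "sharper_upper new old"
    and less: "\<And>r. r \<in> {0<..<1} \<Longrightarrow> g r < new r"
  shows False
  by (rule upper_sharp[OF _ _ tendsto_lower_power[OF gap] tendsto_mult_power_cancel[OF f(1)] f(2) eq sharper less])
    (use eventually_unit_at_right_0 in \<open>auto elim: eventually_mono\<close>)

section \<open>Size of the gaps at the endpoints\<close>

lemma tendsto_artanh_quotient: "((\<lambda>r::real. artanh r / r) \<longlongrightarrow> 1) (at_right 0)"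
  unfolding artanh_def by real_asymp

lemma tendsto_square_chord:
  fixes f :: "real \<Rightarrow> real"
  assumes "\<And>x. x \<in> {0<..<1} \<Longrightarrow> c < f x" "\<And>x. x \<in> {0<..<1} \<Longrightarrow> f x < c + C * x"
  shows "((\<lambda>r. f (r\<^sup>2)) \<longlongrightarrow> c) (at_right 0)"
proof (rule tendsto_sandwich[of "\<lambda>_. c" _ _ "\<lambda>r. c + C * r\<^sup>2"])
  have "((\<lambda>r::real. c + C * r\<^sup>2) \<longlongrightarrow> c + C * 0\<^sup>2) (at_right 0)"
    by (intro tendsto_intros)
  then show "((\<lambda>r::real. c + C * r\<^sup>2) \<longlongrightarrow> c) (at_right 0)"
    by simp
  show "eventually (\<lambda>r. c \<le> f (r\<^sup>2)) (at_right 0)" "eventually (\<lambda>r. f (r\<^sup>2) \<le> c + C * r\<^sup>2) (at_right 0)"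
    using eventually_unit_at_right_0
    by (eventually_elim; use assms square_unit in \<open>force intro!: less_imp_le\<close>)+
qed simp

lemma tendsto_f7_square: "((\<lambda>r. f7 (r\<^sup>2)) \<longlongrightarrow> pi / 8) (at_right 0)"
  by (rule tendsto_square_chord[OF f7_bounds])

lemma tendsto_tail_square: "((\<lambda>r. tail (r\<^sup>2)) \<longlongrightarrow> 40472969 / 5519360000) (at_right 0)"
  by (rule tendsto_square_chord[OF tail_bounds(1,3)])

lemma filterlim_square_at_left_1: "filterlim (\<lambda>r::real. r\<^sup>2) (at_left 1) (at_left 1)"
  by real_asymp

text \<open>Since \<open>tail 1\<close> exceeds the value of \<open>tail\<close> at
  \<open>0\<close>, this gap is of exact order \<open>r ^ 8\<close>, so \<open>r ^ 6\<close> is the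
  highest even power that can be used here.\<close>

lemma lower_gap_0: "((\<lambda>r. (lower_inner [pi / 8] r - lower_outer lower_params r) / r ^ 6) \<longlongrightarrow> 0) (at_right 0)"
proof (rule Lim_transform_eventually)
  have "((\<lambda>r. 3 * pi / 8 * (artanh r / r) * (tail 1 - tail (r\<^sup>2)) * r\<^sup>2) \<longlongrightarrow>
      3 * pi / 8 * 1 * (tail 1 - 40472969 / 5519360000) * 0\<^sup>2) (at_right 0)"
    by (intro tendsto_intros tendsto_artanh_quotient tendsto_tail_square)
  then show "((\<lambda>r. 3 * pi / 8 * (artanh r / r) * (tail 1 - tail (r\<^sup>2)) * r\<^sup>2) \<longlongrightarrow> 0) (at_right 0)"
    by simp
  show "eventually (\<lambda>r. 3 * pi / 8 * (artanh r / r) * (tail 1 - tail (r\<^sup>2)) * r\<^sup>2 =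
      (lower_inner [pi / 8] r - lower_outer lower_params r) / r ^ 6) (at_right 0)"
    using eventually_unit_at_right_0
  proof eventually_elim
    case (elim r)
    then have "r ^ 8 / r ^ 6 = r\<^sup>2"
      by (simp flip: power_diff)
    then show ?case
      unfolding lower_gap[OF elim] times_divide_eq_right[symmetric, of _ "r ^ 8"] by simp
  qed
qed

text \<open>Here \<open>tail\<close> is compared with its own value at \<open>0\<close>, which gains
  a further vanishing factor beyond \<open>r ^ 8\<close>.\<close>

lemma upper_gap_0:
  "((\<lambda>r. (upper_outer upper_params r - upper_inner [pi / 8, ln 2 - pi / 8] r) / r ^ 8) \<longlongrightarrow> 0) (at_right 0)"
proof (rule Lim_transform_eventually)
  have "((\<lambda>r. 3 * pi / 8 * (artanh r / r) * (tail (r\<^sup>2) - 40472969 / 5519360000)) \<longlongrightarrow>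
      3 * pi / 8 * 1 * (40472969 / 5519360000 - 40472969 / 5519360000)) (at_right 0)"
    by (intro tendsto_intros tendsto_artanh_quotient tendsto_tail_square)
  then show "((\<lambda>r. 3 * pi / 8 * (artanh r / r) * (tail (r\<^sup>2) - 40472969 / 5519360000)) \<longlongrightarrow> 0) (at_right 0)"
    by simp
  show "eventually (\<lambda>r. 3 * pi / 8 * (artanh r / r) * (tail (r\<^sup>2) - 40472969 / 5519360000) =
      (upper_outer upper_params r - upper_inner [pi / 8, ln 2 - pi / 8] r) / r ^ 8) (at_right 0)"
    using eventually_unit_at_right_0 by eventually_elim (simp add: upper_gap)
qed

text \<open>The bounds involve the unbounded factor \<open>artanh r / r\<close>; relative to it the
  gap vanishes because \<open>tail\<close> is continuous at \<open>1\<close>.\<close>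

lemma lower_gap_1:
  "((\<lambda>r. (lower_inner [pi / 8] r - lower_outer lower_params r) / (artanh r / r)) \<longlongrightarrow> 0) (at_left 1)"
proof (rule Lim_transform_eventually)
  have "((\<lambda>r. 3 * pi / 8 * (tail 1 - tail (r\<^sup>2)) * r ^ 8) \<longlongrightarrow> 3 * pi / 8 * (tail 1 - tail 1) * 1 ^ 8) (at_left 1)"
    by (intro tendsto_intros filterlim_compose[OF tail_tendsto_1 filterlim_square_at_left_1])
  then show "((\<lambda>r. 3 * pi / 8 * (tail 1 - tail (r\<^sup>2)) * r ^ 8) \<longlongrightarrow> 0) (at_left 1)"
    by simp
  show "eventually (\<lambda>r. 3 * pi / 8 * (tail 1 - tail (r\<^sup>2)) * r ^ 8 =
      (lower_inner [pi / 8] r - lower_outer lower_params r) / (artanh r / r)) (at_left 1)"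
    using eventually_unit_at_left_1
  proof eventually_elim
    case (elim r)
    have "c * A * T * R / A = c * T * R" if "0 < A" for c A T R :: real
      using that by simp
    note cancel = this[OF artanh_quotient_pos[OF elim]]
    show ?case
      unfolding lower_gap[OF elim] by (rule cancel[symmetric])
  qed
qed

lemma ellipticK_gap_lower_0:
  "((\<lambda>r. (ellipticK r - lower_inner [pi / 8] r) / r ^ 0) \<longlongrightarrow> 0) (at_right 0)"
proof (rule Lim_transform_eventually)
  have "((\<lambda>r. f7 (r\<^sup>2) - pi / 8) \<longlongrightarrow> pi / 8 - pi / 8) (at_right 0)"
    by (intro tendsto_intros tendsto_f7_square)
  then show "((\<lambda>r. f7 (r\<^sup>2) - pi / 8) \<longlongrightarrow> 0) (at_right 0)"
    by simp
  show "eventually (\<lambda>r. f7 (r\<^sup>2) - pi / 8 = (ellipticK r - lower_inner [pi / 8] r) / r ^ 0) (at_right 0)"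
    using eventually_unit_at_right_0 by eventually_elim (simp add: ellipticK_gaps)
qed

lemma ellipticK_gap_upper_0:
  "((\<lambda>r. (upper_inner [pi / 8, ln 2 - pi / 8] r - ellipticK r) / r ^ 0) \<longlongrightarrow> 0) (at_right 0)"
proof (rule Lim_transform_eventually)
  have "((\<lambda>r. pi / 8 + (ln 2 - pi / 8) * r\<^sup>2 - f7 (r\<^sup>2)) \<longlongrightarrow> pi / 8 + (ln 2 - pi / 8) * 0\<^sup>2 - pi / 8) (at_right 0)"
    by (intro tendsto_intros tendsto_f7_square)
  then show "((\<lambda>r. pi / 8 + (ln 2 - pi / 8) * r\<^sup>2 - f7 (r\<^sup>2)) \<longlongrightarrow> 0) (at_right 0)"
    by simp
  show "eventually (\<lambda>r. pi / 8 + (ln 2 - pi / 8) * r\<^sup>2 - f7 (r\<^sup>2) =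
      (upper_inner [pi / 8, ln 2 - pi / 8] r - ellipticK r) / r ^ 0) (at_right 0)"
    using eventually_unit_at_right_0 by eventually_elim (simp add: ellipticK_gaps)
qed

text \<open>The chord ends at \<open>ln 2\<close>, the limit of \<open>f7\<close> at
  \<open>1\<close>.\<close>

lemma ellipticK_gap_upper_1:
  "((\<lambda>r. (upper_inner [pi / 8, ln 2 - pi / 8] r - ellipticK r) / 1) \<longlongrightarrow> 0) (at_left 1)"
proof (rule Lim_transform_eventually)
  have "((\<lambda>r. pi / 8 + (ln 2 - pi / 8) * r\<^sup>2 - f7 (r\<^sup>2)) \<longlongrightarrow> pi / 8 + (ln 2 - pi / 8) * 1\<^sup>2 - ln 2) (at_left 1)"
    by (intro tendsto_intros filterlim_compose[OF f7_tendsto_1 filterlim_square_at_left_1])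
  then show "((\<lambda>r. pi / 8 + (ln 2 - pi / 8) * r\<^sup>2 - f7 (r\<^sup>2)) \<longlongrightarrow> 0) (at_left 1)"
    by simp
  show "eventually (\<lambda>r. pi / 8 + (ln 2 - pi / 8) * r\<^sup>2 - f7 (r\<^sup>2) =
      (upper_inner [pi / 8, ln 2 - pi / 8] r - ellipticK r) / 1) (at_left 1)"
    using eventually_unit_at_left_1 by eventually_elim (simp add: ellipticK_gaps)
qed

section \<open>Optimality of the individual constants\<close>

text \<open>The first six constants act at order \<open>r ^ 6\<close> or lower and are tested at
  \<open>0\<close>. The coefficient of \<open>r ^ 8\<close> acts there at the order of the gap
  itself, so it is tested at \<open>1\<close>.\<close>

lemma lower_outer_sharp:
  assumes i: "i < 7" and sharper: "sharper_lower (lower_outer (lower_params[i := c])) (lower_outer lower_params)"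
  shows "\<not> K_chain (lower_outer (lower_params[i := c])) (lower_inner [pi / 8]) u1 u2"
proof
  assume "K_chain (lower_outer (lower_params[i := c])) (lower_inner [pi / 8]) u1 u2"
  then have less: "lower_outer (lower_params[i := c]) r < lower_inner [pi / 8] r" if "r \<in> {0<..<1}" for r
    using that by (simp add: K_chain_def)
  note sharp = lower_sharp_0[OF lower_gap_0 _ _ _ _ sharper less]
  define A where "A r = artanh r / r" for r :: real
  have L: "lower_outer p r = p!0 + p!1 * (p!2 - p!3 * r^2 - p!4 * r^4 - p!5 * r^6 - p!6 * r^8) * A r" for p r
    by (simp only: lower_outer_def A_def)
  have A: "(A \<longlongrightarrow> 1) (at_right 0)"
    using tendsto_artanh_quotient by (simp only: A_def[abs_def])
  have cA: "((\<lambda>r. 3 * pi / 8 * A r) \<longlongrightarrow> 3 * pi / 8 * 1) (at_right 0)"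
    by (intro tendsto_intros A)
  have pA: "((\<lambda>r. (lower_params ! 2 - lower_params ! 3 * r ^ 2 - lower_params ! 4 * r ^ 4
        - lower_params ! 5 * r ^ 6 - lower_params ! 6 * r ^ 8) * A r) \<longlongrightarrow>
      (lower_params ! 2 - lower_params ! 3 * 0 ^ 2 - lower_params ! 4 * 0 ^ 4
        - lower_params ! 5 * 0 ^ 6 - lower_params ! 6 * 0 ^ 8) * 1) (at_right 0)"
    by (intro tendsto_intros A)
  consider "i = 0" | "i = 1" | "i = 2" | "i = 3" | "i = 4" | "i = 5" | "i = 6"
    using i by linarith
  then show False
  proof cases
    \<comment> \<open>The cases are numbered from \<open>1\<close>, the constants from
      \<open>0\<close>.\<close>
    case 1
    show ?thesis
      by (rule sharp[where k = 0 and d = "c - pi / 8" and f = "\<lambda>_. 1" and m = 1])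
        (simp_all add: 1 L lower_params_def)
  next
    case 2
    \<comment> \<open>Changing the outer factor rescales the whole polynomial, whose product with
      \<open>A\<close> tends to \<open>1\<close> at \<open>0\<close>. The identity is proved for
      abstract \<open>P\<close> and \<open>B\<close> so that the polynomial is not expanded.\<close>
    have eq: "lower_outer (lower_params[i := c]) r - lower_outer lower_params r = (c - 3 * pi / 8) * ((lower_params ! 2 - lower_params ! 3 * r ^ 2 - lower_params ! 4 * r ^ 4 - lower_params ! 5 * r ^ 6 - lower_params ! 6 * r ^ 8) * A r * r ^ 0)" for r
    proof -
      have "x + y * P * B - (x + z * P * B) = (y - z) * (P * B * r ^ 0)" for x y P B z :: real
        by (simp add: algebra_simps)
      from this[of "lower_params ! 0" c "lower_params ! 2 - lower_params ! 3 * r ^ 2 - lower_params ! 4 * r ^ 4 - lower_params ! 5 * r ^ 6 - lower_params ! 6 * r ^ 8" "A r" "3 * pi / 8"] show ?thesis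
        by (simp add: 2 L lower_params_def)
    qed
    show ?thesis
      by (rule sharp[OF _ pA _ eq]) (simp_all add: lower_params_def)
  next
    case 3
    show ?thesis
      by (rule sharp[where k = 0 and d = "c - 1", OF _ cA])
        (simp_all add: 3 L lower_params_def left_diff_distrib right_diff_distrib)
  next
    case 4
    show ?thesis
      by (rule sharp[where k = 2 and d = "3 / 40 - c", OF _ cA])
        (simp_all add: 4 L lower_params_def left_diff_distrib right_diff_distrib)
  next
    case 5
    show ?thesis
      by (rule sharp[where k = 4 and d = "267 / 11200 - c", OF _ cA])
        (simp_all add: 5 L lower_params_def left_diff_distrib right_diff_distrib)
  next
    case 6
    show ?thesis
      by (rule sharp[where k = 6 and d = "32279 / 2688000 - c", OF _ cA])
        (simp_all add: 6 L lower_params_def left_diff_distrib right_diff_distrib)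
  next
    case 7
    \<comment> \<open>The scale at \<open>1\<close> is \<open>A\<close> itself; relative to it the
      effect tends to \<open>3 * pi / 8\<close>.\<close>
    have "((\<lambda>r. 3 * pi / 8 * A r * r ^ 8 / A r) \<longlongrightarrow> 3 * pi / 8) (at_left 1)"
    proof (rule Lim_transform_eventually)
      have "((\<lambda>r. 3 * pi / 8 * r ^ 8) \<longlongrightarrow> 3 * pi / 8 * 1 ^ 8) (at_left (1::real))"
        by (intro tendsto_intros)
      then show "((\<lambda>r. 3 * pi / 8 * r ^ 8) \<longlongrightarrow> 3 * pi / 8) (at_left (1::real))"
        by simp
      show "eventually (\<lambda>r. 3 * pi / 8 * r ^ 8 = 3 * pi / 8 * A r * r ^ 8 / A r) (at_left 1)"
        using eventually_unit_at_left_1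
        by eventually_elim (use artanh_quotient_pos in \<open>fastforce simp: A_def\<close>)
    qed
    moreover have "((\<lambda>r. (lower_inner [pi / 8] r - lower_outer lower_params r) / A r) \<longlongrightarrow> 0) (at_left 1)"
      using lower_gap_1 by (simp only: A_def)
    moreover have "eventually (\<lambda>r. r \<in> {0<..<1} \<and> 0 < A r) (at_left 1)"
      using eventually_unit_at_left_1 by eventually_elim (use artanh_quotient_pos in \<open>simp add: A_def\<close>)
    moreover have "lower_outer (lower_params[i := c]) r - lower_outer lower_params r =
        (2390041 / 2688000 - 8 / (3 * pi) - c) * (3 * pi / 8 * A r * r ^ 8)" for r
      by (simp add: 7 L lower_params_def left_diff_distrib right_diff_distrib)
    ultimately show ?thesis
      using lower_sharp[OF trivial_limit_at_left_real _ _ _ _ _ sharper less] by fastforce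
  qed
qed

lemma lower_inner_sharp:
  assumes sharper: "sharper_lower (lower_inner [c]) (lower_inner [pi / 8])"
  shows "\<not> K_chain l1 (lower_inner [c]) u1 u2"
proof
  assume "K_chain l1 (lower_inner [c]) u1 u2"
  then have less: "lower_inner [c] r < ellipticK r" if "r \<in> {0<..<1}" for r
    using that by (simp add: K_chain_def)
  show False
    by (rule lower_sharp_0[OF ellipticK_gap_lower_0 _ _ _ _ sharper less,
          where k = 0 and d = "c - pi / 8" and f = "\<lambda>_. 1" and m = 1])
      (simp_all add: lower_inner_def)
qed

lemma upper_inner_sharp:
  assumes i: "i < 2" and sharper: "sharper_upper (upper_inner ([pi / 8, ln 2 - pi / 8][i := c])) (upper_inner [pi / 8, ln 2 - pi / 8])"
  shows "\<not> K_chain l1 l2 (upper_inner ([pi / 8, ln 2 - pi / 8][i := c])) u2"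
proof
  assume "K_chain l1 l2 (upper_inner ([pi / 8, ln 2 - pi / 8][i := c])) u2"
  then have less: "ellipticK r < upper_inner ([pi / 8, ln 2 - pi / 8][i := c]) r" if "r \<in> {0<..<1}" for r
    using that by (simp add: K_chain_def)
  consider "i = 0" | "i = 1"
    using i by linarith
  then show False
  proof cases
    case 1
    show ?thesis
      by (rule upper_sharp_0[OF ellipticK_gap_upper_0 _ _ _ _ sharper less,
            where k = 0 and d = "pi / 8 - c" and f = "\<lambda>_. 1" and m = 1])
        (simp_all add: 1 upper_inner_def)
  next
    case 2
    \<comment> \<open>The gap closes at \<open>1\<close>, while the effect \<open>r\<^sup>2\<close>
      tends to \<open>1\<close> there, so the scale is constant.\<close>
    have lim: "((\<lambda>r. r\<^sup>2 / 1) \<longlongrightarrow> 1\<^sup>2 / 1) (at_left (1::real))"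
      by (intro tendsto_intros) simp
    show ?thesis
      by (rule upper_sharp[where d = "ln 2 - pi / 8 - c", OF _ _ ellipticK_gap_upper_1 lim _ _ sharper less])
        (use eventually_unit_at_left_1 in \<open>simp_all add: 2 upper_inner_def left_diff_distrib\<close>)
  qed
qed

text \<open>The gap is of smaller order than \<open>r ^ 8\<close> at \<open>0\<close>, so all eight
  constants can be tested there.\<close>

lemma upper_outer_sharp:
  assumes i: "i < 8" and sharper: "sharper_upper (upper_outer (upper_params[i := c])) (upper_outer upper_params)"
  shows "\<not> K_chain l1 l2 (upper_inner [pi / 8, ln 2 - pi / 8]) (upper_outer (upper_params[i := c]))"
proof
  assume "K_chain l1 l2 (upper_inner [pi / 8, ln 2 - pi / 8]) (upper_outer (upper_params[i := c]))"
  then have less: "upper_inner [pi / 8, ln 2 - pi / 8] r < upper_outer (upper_params[i := c]) r"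
    if "r \<in> {0<..<1}" for r
    using that by (simp add: K_chain_def)
  note sharp = upper_sharp_0[OF upper_gap_0 _ _ _ _ sharper less]
  define A where "A r = artanh r / r" for r :: real
  have L: "upper_outer p r = p!0 + p!1 * r^2 + p!2 * (p!3 - p!4 * r^2 - p!5 * r^4 - p!6 * r^6 - p!7 * r^8) * A r" for p r
    by (simp only: upper_outer_def A_def)
  have A: "(A \<longlongrightarrow> 1) (at_right 0)"
    using tendsto_artanh_quotient by (simp only: A_def[abs_def])
  have cA: "((\<lambda>r. 3 * pi / 8 * A r) \<longlongrightarrow> 3 * pi / 8 * 1) (at_right 0)"
    by (intro tendsto_intros A)
  have pA: "((\<lambda>r. (upper_params ! 3 - upper_params ! 4 * r ^ 2 - upper_params ! 5 * r ^ 4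
        - upper_params ! 6 * r ^ 6 - upper_params ! 7 * r ^ 8) * A r) \<longlongrightarrow>
      (upper_params ! 3 - upper_params ! 4 * 0 ^ 2 - upper_params ! 5 * 0 ^ 4
        - upper_params ! 6 * 0 ^ 6 - upper_params ! 7 * 0 ^ 8) * 1) (at_right 0)"
    by (intro tendsto_intros A)
  consider "i = 0" | "i = 1" | "i = 2" | "i = 3" | "i = 4" | "i = 5" | "i = 6" | "i = 7"
    using i by linarith
  then show False
  proof cases
    case 1
    show ?thesis
      by (rule sharp[where k = 0 and d = "pi / 8 - c" and f = "\<lambda>_. 1" and m = 1])
        (simp_all add: 1 L upper_params_def)
  next
    case 2
    show ?thesis
      by (rule sharp[where k = 2 and d = "ln 2 - pi / 8 - c" and f = "\<lambda>_. 1" and m = 1])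
        (simp_all add: 2 L upper_params_def left_diff_distrib)
  next
    case 3
    have eq: "upper_outer upper_params r - upper_outer (upper_params[i := c]) r = (3 * pi / 8 - c) * ((upper_params ! 3 - upper_params ! 4 * r ^ 2 - upper_params ! 5 * r ^ 4 - upper_params ! 6 * r ^ 6 - upper_params ! 7 * r ^ 8) * A r * r ^ 0)" for r
    proof -
      have "x + y * P * B - (x + z * P * B) = (y - z) * (P * B * r ^ 0)" for x y P B z :: real
        by (simp add: algebra_simps)
      from this[of "upper_params ! 0 + upper_params ! 1 * r ^ 2" "3 * pi / 8" "upper_params ! 3 - upper_params ! 4 * r ^ 2 - upper_params ! 5 * r ^ 4 - upper_params ! 6 * r ^ 6 - upper_params ! 7 * r ^ 8" "A r" c] show ?thesis
        by (simp add: 3 L upper_params_def)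
    qed
    show ?thesis
      by (rule sharp[OF _ pA _ eq]) (simp_all add: upper_params_def)
  next
    case 4
    show ?thesis
      by (rule sharp[where k = 0 and d = "1 - c", OF _ cA])
        (simp_all add: 4 L upper_params_def left_diff_distrib right_diff_distrib)
  next
    case 5
    show ?thesis
      by (rule sharp[where k = 2 and d = "c - 3 / 40", OF _ cA])
        (simp_all add: 5 L upper_params_def left_diff_distrib right_diff_distrib)
  next
    case 6
    show ?thesis
      by (rule sharp[where k = 4 and d = "c - 267 / 11200", OF _ cA])
        (simp_all add: 6 L upper_params_def left_diff_distrib right_diff_distrib)
  next
    case 7
    show ?thesis
      by (rule sharp[where k = 6 and d = "c - 32279 / 2688000", OF _ cA])
        (simp_all add: 7 L upper_params_def left_diff_distrib right_diff_distrib)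
  next
    case 8
    show ?thesis
      by (rule sharp[where k = 8 and d = "c - 40472969 / 5519360000", OF _ cA])
        (simp_all add: 8 L upper_params_def left_diff_distrib right_diff_distrib)
  qed
qed

theorem corollary4p1:
  shows "(\<forall>a::real. 0 < a \<and> a < 1 \<longrightarrow>
      absolutely_monotone_on (f6 a) {0<..<1} \<and>
      f6 a ` {0<..<1} = {pi * eta_const a / 2 <..< pi * beta_const a / 2}) \<and>
    absolutely_monotone_on f7 {0<..<1} \<and>
    f7 ` {0<..<1} = {pi / 8 <..< ln 2} \<and>
    (\<forall>r::real. 0 < r \<and> r < 1 \<longrightarrow>
      pi / 8 + 3 * pi / 8 * (1 - 3 / 40 * r^2 - 267 / 11200 * r^4 - 32279 / 2688000 * r^6
          - (2390041 / 2688000 - 8 / (3 * pi)) * r^8) * (artanh r / r)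
        < pi / 8 + h13 (r^2) * (artanh r / r) \<and>
      pi / 8 + h13 (r^2) * (artanh r / r) < ellipticK r \<and>
      ellipticK r < pi / 8 + h13 (r^2) * (artanh r / r) + (ln 2 - pi / 8) * r^2 \<and>
      pi / 8 + h13 (r^2) * (artanh r / r) + (ln 2 - pi / 8) * r^2
        < pi / 8 + (ln 2 - pi / 8) * r^2
          + 3 * pi / 8 * (1 - 3 / 40 * r^2 - 267 / 11200 * r^4 - 32279 / 2688000 * r^6
              - 40472969 / 5519360000 * r^8) * (artanh r / r)) \<and>
    (let p = [pi / 8, 3 * pi / 8, 1, 3 / 40, 267 / 11200, 32279 / 2688000,
              2390041 / 2688000 - 8 / (3 * pi)];
         q = [pi / 8];
         s = [pi / 8, ln 2 - pi / 8];
         t = [pi / 8, ln 2 - pi / 8, 3 * pi / 8, 1, 3 / 40, 267 / 11200, 32279 / 2688000,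
              40472969 / 5519360000]
     in
      (\<forall>i<length p. \<forall>c. sharper_lower (lower_outer (p[i := c])) (lower_outer p) \<longrightarrow>
        \<not> K_chain (lower_outer (p[i := c])) (lower_inner q) (upper_inner s) (upper_outer t)) \<and>
      (\<forall>i<length q. \<forall>c. sharper_lower (lower_inner (q[i := c])) (lower_inner q) \<longrightarrow>
        \<not> K_chain (lower_outer p) (lower_inner (q[i := c])) (upper_inner s) (upper_outer t)) \<and>
      (\<forall>i<length s. \<forall>c. sharper_upper (upper_inner (s[i := c])) (upper_inner s) \<longrightarrow>
        \<not> K_chain (lower_outer p) (lower_inner q) (upper_inner (s[i := c])) (upper_outer t)) \<and>
      (\<forall>i<length t. \<forall>c. sharper_upper (upper_outer (t[i := c])) (upper_outer t) \<longrightarrow>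
        \<not> K_chain (lower_outer p) (lower_inner q) (upper_inner s) (upper_outer (t[i := c]))))"
proof -
  have chain': "pi / 8 + 3 * pi / 8 * (1 - 3 / 40 * r^2 - 267 / 11200 * r^4 - 32279 / 2688000 * r^6
          - (2390041 / 2688000 - 8 / (3 * pi)) * r^8) * (artanh r / r)
        < pi / 8 + h13 (r^2) * (artanh r / r) \<and>
      pi / 8 + h13 (r^2) * (artanh r / r) < ellipticK r \<and>
      ellipticK r < pi / 8 + h13 (r^2) * (artanh r / r) + (ln 2 - pi / 8) * r^2 \<and>
      pi / 8 + h13 (r^2) * (artanh r / r) + (ln 2 - pi / 8) * r^2
        < pi / 8 + (ln 2 - pi / 8) * r^2
          + 3 * pi / 8 * (1 - 3 / 40 * r^2 - 267 / 11200 * r^4 - 32279 / 2688000 * r^6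
              - 40472969 / 5519360000 * r^8) * (artanh r / r)" if "0 < r" "r < 1" for r
  proof -
    have "r \<in> {0<..<1}"
      using that by simp
    from ellipticK_chain[OF this] show ?thesis
      unfolding lower_outer_def lower_inner_def upper_inner_def upper_outer_def
        lower_params_def upper_params_def
      \<comment> \<open>List lookup alone is evaluated, so that the inequalities keep the shape of
        the statement.\<close>
      by (simp only: nth_Cons_0 nth_Cons_numeral One_nat_def nth_Cons_Suc numeral_eq_Suc pred_numeral_simps BitM.simps)
  qed
  show ?thesis
    unfolding Let_def lower_params_def[symmetric] upper_params_def[symmetric]
  proof (intro conjI allI impI; (elim conjE)?)
    show "absolutely_monotone_on (f6 a) {0<..<1}" if "0 < a" "a < 1" for a
      using that by (rule absolutely_monotone_f6)
    show "f6 a ` {0<..<1} = {pi * eta_const a / 2<..<pi * beta_const a / 2}" if "0 < a" "a < 1" for a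
      using that by (rule f6_image)
  qed (use absolutely_monotone_f7 f7_image chain' lower_outer_sharp lower_inner_sharp upper_inner_sharp upper_outer_sharp
        in \<open>auto simp: lower_params_def upper_params_def\<close>)
qed

end
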